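(* There is a universal constant $c>0$ such that for all $L,T>0$, $\Phi\ge0$ and every measure $\mu\in\mathcal A^*_{L,T}$ with $\mu_{\pm T}=\Phi L^{-2}dx'$ one has $$I(\mu)\ge c\left(\frac{T\Phi^{1/2}}{L^2}+\frac{T^{1/3}\Phi^{2/3}}{L^{4/3}}\right).$$
   Context: Notation. $Q_L:=(-\frac L2,\frac L2)^2$, $Q_{L,T}:=Q_L\times(-T,T)$, $x=(x',x_3)$. Everything is $Q_L$-periodic in $x'$, i.e. $Q_L$ is identified with the torus $\mathbb R^2/L\mathbb Z^2$. $\mathcal M^+$ denotes finite positive Radon measures and $\mathcal M(\cdot;\mathbb R^2)$ finite vector-valued Radon measures; $dx'$ is two-dimensional Lebesgue measure. $\mathcal A_{L,T}$ is the set of pairs $\mu\in\mathcal M^+(Q_{L,T})$, $m\in\mathcal M(Q_{L,T};\mathbb R^2)$ with $m\ll\mu$, $\partial_3\mu+\mathrm{div}'m=0$ in $Q_{L,T}$ (distributionally, periodically in $x'$), and $\mu=\mu_{x_3}\otimes dx_3$ where for a.e. $x_3\in(-T,T)$, $\mu_{x_3}=\sum_i\varphi_i\delta_{X_i}$ (at most countable, $\varphi_i>0$, $X_i\in Q_L$). $\mathcal A^*_{L,T}:=\{\mu:\exists m,\ (\mu,m)\in\mathcal A_{L,T}\}$. With $K_*:=\frac{8\sqrt\pi}3$ and $\mu_{x_3}(x'):=\mu_{x_3}(\{x'\})$, $$I(\mu,m):=\frac{K_*}{L^2}\int_{-T}^T\sum_{x'\in Q_L}(\mu_{x_3}(x'))^{1/2}dx_3+\frac1{L^2}\int_{Q_{L,T}}\left|\frac{dm}{d\mu}\right|^2d\mu,\qquad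 I(\mu):=\min\{I(\mu,m):\ m\ll\mu,\ \partial_3\mu+\mathrm{div}'m=0\}.$$ When $I(\mu)<\infty$ the map $x_3\mapsto\mu_{x_3}$ has a weakly continuous representative on $[-T,T]$, which is always used; in particular the traces $\mu_{\pm T}$ are defined. (If $I(\mu)=+\infty$ the inequality is trivial.) *)

theory Defs
  imports "HOL-Analysis.Analysis"
begin

text \<open>
  The torus \<open>Q\<^sub>L\<close> is represented by a half-open fundamental cell, which carries the same Borel
  sets as the torus; its topology and smooth structure enter only through functions on the whole
  plane that are \<open>L\<close>-periodic in each coordinate. Points of the cylinder are pairs \<open>(x', x\<^sub>3)\<close>.
\<close>

definition cell :: "real \<Rightarrow> (real^2) set" where
  "cell L = {x. \<forall>i. - L / 2 \<le> x $ i \<and> x $ i < L / 2}"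

definition cyl :: "real \<Rightarrow> real \<Rightarrow> ((real^2) \<times> real) set" where
  "cyl L T = cell L \<times> {-T<..<T}"

definition periodic :: "real \<Rightarrow> (real^2 \<Rightarrow> 'b) \<Rightarrow> bool" where
  "periodic L \<psi> \<longleftrightarrow> (\<forall>x i. \<psi> (x + L *\<^sub>R axis i 1) = \<psi> x)"

text \<open>On Borel subsets of Euclidean space every finite Borel measure is Radon.\<close>

definition finite_measures_on :: "'a::topological_space set \<Rightarrow> 'a measure set" where
  "finite_measures_on X = {\<sigma>. finite_measure \<sigma> \<and> sets \<sigma> = sets (restrict_space borel X)}"

text \<open>
  A vector measure is a countably additive set function; only its values on \<open>sets M\<close> matter.
  The measure \<open>M\<close> serves here only to supply the \<open>\<sigma>\<close>-algebra.
\<close>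

definition vector_measure :: "'a measure \<Rightarrow> ('a set \<Rightarrow> 'b::real_normed_vector) \<Rightarrow> bool" where
  "vector_measure M m \<longleftrightarrow>
     (\<forall>A :: nat \<Rightarrow> 'a set. range A \<subseteq> sets M \<longrightarrow> disjoint_family A \<longrightarrow>
        (\<lambda>i. m (A i)) sums m (\<Union>i. A i))"

definition vector_abs_cont :: "'a measure \<Rightarrow> ('a set \<Rightarrow> 'b::real_normed_vector) \<Rightarrow> bool" where
  "vector_abs_cont M m \<longleftrightarrow> (\<forall>A\<in>null_sets M. m A = 0)"

text \<open>
  The density \<open>dm/dM\<close>: it exists by the Radon--Nikodym theorem when \<open>M\<close> is finite and \<open>m\<close> is an
  \<open>M\<close>-absolutely continuous vector measure, and it is unique up to \<open>M\<close>-null sets.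
\<close>

definition vector_RN_deriv ::
    "'a measure \<Rightarrow> ('a set \<Rightarrow> 'b::euclidean_space) \<Rightarrow> 'a \<Rightarrow> 'b" where
  "vector_RN_deriv M m =
     (SOME v. integrable M v \<and> (\<forall>A\<in>sets M. m A = set_lebesgue_integral M A v))"

primrec Ck :: "nat \<Rightarrow> ('a::euclidean_space \<Rightarrow> real) \<Rightarrow> bool" where
  "Ck 0 f \<longleftrightarrow> continuous_on UNIV f"
| "Ck (Suc n) f \<longleftrightarrow> (\<forall>x. f differentiable (at x)) \<and>
     (\<forall>b\<in>Basis. Ck n (\<lambda>x. frechet_derivative f (at x) b))"

definition test_function :: "real \<Rightarrow> real \<Rightarrow> ((real^2) \<times> real \<Rightarrow> real) \<Rightarrow> bool" where
  "test_function L T \<phi> \<longleftrightarrow>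
     (\<forall>n. Ck n \<phi>) \<and> (\<forall>t. periodic L (\<lambda>x. \<phi> (x, t))) \<and>
     (\<exists>s<T. \<forall>x t. s \<le> \<bar>t\<bar> \<longrightarrow> \<phi> (x, t) = 0)"

definition d3 :: "((real^2) \<times> real \<Rightarrow> real) \<Rightarrow> (real^2) \<times> real \<Rightarrow> real" where
  "d3 \<phi> p = frechet_derivative \<phi> (at p) (0, 1)"

definition grad' :: "((real^2) \<times> real \<Rightarrow> real) \<Rightarrow> (real^2) \<times> real \<Rightarrow> real^2" where
  "grad' \<phi> p = (\<chi> i. frechet_derivative \<phi> (at p) (axis i 1, 0))"

text \<open>
  The distributional equation \<open>\<partial>\<^sub>3\<mu> + div' m = 0\<close>, for \<open>m\<close> absolutely continuous with respect to
  \<open>\<mu>\<close>, so that integration against \<open>m\<close> is integration of the density against \<open>\<mu>\<close>.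
\<close>

definition continuity_equation ::
    "real \<Rightarrow> real \<Rightarrow> ((real^2) \<times> real) measure \<Rightarrow> (((real^2) \<times> real) set \<Rightarrow> real^2) \<Rightarrow> bool" where
  "continuity_equation L T \<mu> m \<longleftrightarrow>
     (\<forall>\<phi>. test_function L T \<phi> \<longrightarrow>
        (\<integral>p. d3 \<phi> p \<partial>\<mu>) + (\<integral>p. grad' \<phi> p \<bullet> vector_RN_deriv \<mu> m p \<partial>\<mu>) = 0)"

definition fluxes ::
    "real \<Rightarrow> real \<Rightarrow> ((real^2) \<times> real) measure \<Rightarrow> (((real^2) \<times> real) set \<Rightarrow> real^2) set" where
  "fluxes L T \<mu> = {m. vector_measure \<mu> m \<and> vector_abs_cont \<mu> m \<and> continuity_equation L T \<mu> m}"

text \<open>The slicing \<open>\<mu> = \<nu>\<^sub>t \<otimes> dt\<close> on the open interval; values of \<open>\<nu>\<close> outside it are irrelevant.\<close>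

definition slicing ::
    "real \<Rightarrow> real \<Rightarrow> ((real^2) \<times> real) measure \<Rightarrow> (real \<Rightarrow> (real^2) measure) \<Rightarrow> bool" where
  "slicing L T \<mu> \<nu> \<longleftrightarrow>
     (\<forall>t\<in>{-T<..<T}. \<nu> t \<in> finite_measures_on (cell L)) \<and>
     (\<forall>B\<in>sets (restrict_space borel (cell L)).
        (\<lambda>t. emeasure (\<nu> t) B) \<in> borel_measurable (restrict_space borel {-T<..<T})) \<and>
     (\<forall>A\<in>sets \<mu>.
        emeasure \<mu> A = (\<integral>\<^sup>+t\<in>{-T<..<T}. emeasure (\<nu> t) {x. (x, t) \<in> A} \<partial>lborel))"

definition purely_atomic :: "real \<Rightarrow> (real^2) measure \<Rightarrow> bool" where
  "purely_atomic L \<sigma> \<longleftrightarrow>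
     (\<exists>S \<phi>. countable S \<and> S \<subseteq> cell L \<and> (\<forall>X\<in>S. \<phi> X > (0::real)) \<and>
        (\<forall>B\<in>sets \<sigma>. emeasure \<sigma> B = (\<integral>\<^sup>+X. ennreal (\<phi> X) * indicator B X \<partial>count_space S)))"

definition admissible ::
    "real \<Rightarrow> real \<Rightarrow> (((real^2) \<times> real) measure \<times> (((real^2) \<times> real) set \<Rightarrow> real^2)) set" where
  "admissible L T =
     {(\<mu>, m). \<mu> \<in> finite_measures_on (cyl L T) \<and> m \<in> fluxes L T \<mu> \<and>
        (\<exists>\<nu>. slicing L T \<mu> \<nu> \<and> (AE t in lborel. t \<in> {-T<..<T} \<longrightarrow> purely_atomic L (\<nu> t)))}"

definition admissible_star :: "real \<Rightarrow> real \<Rightarrow> ((real^2) \<times> real) measure set" where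
  "admissible_star L T = {\<mu>. \<exists>m. (\<mu>, m) \<in> admissible L T}"

text \<open>Any two slicings agree for almost every \<open>t\<close>, so the energy does not depend on the choice.\<close>

definition slice ::
    "real \<Rightarrow> real \<Rightarrow> ((real^2) \<times> real) measure \<Rightarrow> real \<Rightarrow> (real^2) measure" where
  "slice L T \<mu> = (SOME \<nu>. slicing L T \<mu> \<nu>)"

definition K_star :: real where
  "K_star = 8 * sqrt pi / 3"

definition energy ::
    "real \<Rightarrow> real \<Rightarrow> ((real^2) \<times> real) measure \<Rightarrow> (((real^2) \<times> real) set \<Rightarrow> real^2) \<Rightarrow> ennreal"
  where
  "energy L T \<mu> m =
     ennreal (K_star / L\<^sup>2) *
       (\<integral>\<^sup>+t\<in>{-T<..<T}.
          (\<integral>\<^sup>+x. ennreal (sqrt (measure (slice L T \<mu> t) {x})) \<partial>count_space (cell L)) \<partial>lborel) +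
     ennreal (1 / L\<^sup>2) * (\<integral>\<^sup>+p. ennreal ((norm (vector_RN_deriv \<mu> m p))\<^sup>2) \<partial>\<mu>)"

definition min_energy :: "real \<Rightarrow> real \<Rightarrow> ((real^2) \<times> real) measure \<Rightarrow> ennreal" where
  "min_energy L T \<mu> = (INF m\<in>fluxes L T \<mu>. energy L T \<mu> m)"

text \<open>
  The weakly continuous representative of \<open>t \<mapsto> \<mu>\<^sub>t\<close> on the closed interval; it is unique if it
  exists, and it exists whenever the minimal energy is finite.
\<close>

definition weakly_continuous_slicing ::
    "real \<Rightarrow> real \<Rightarrow> ((real^2) \<times> real) measure \<Rightarrow> (real \<Rightarrow> (real^2) measure) \<Rightarrow> bool" where
  "weakly_continuous_slicing L T \<mu> \<nu> \<longleftrightarrow>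
     slicing L T \<mu> \<nu> \<and>
     (\<forall>t\<in>{-T..T}. \<nu> t \<in> finite_measures_on (cell L)) \<and>
     (\<forall>\<psi> :: real^2 \<Rightarrow> real. continuous_on UNIV \<psi> \<longrightarrow> periodic L \<psi> \<longrightarrow>
        continuous_on {-T..T} (\<lambda>t. \<integral>x. \<psi> x \<partial>\<nu> t))"

definition has_trace ::
    "real \<Rightarrow> real \<Rightarrow> ((real^2) \<times> real) measure \<Rightarrow> real \<Rightarrow> (real^2) measure \<Rightarrow> bool" where
  "has_trace L T \<mu> t \<sigma> \<longleftrightarrow> (\<exists>\<nu>. weakly_continuous_slicing L T \<mu> \<nu> \<and> \<nu> t = \<sigma>)"

definition uniform_cell :: "real \<Rightarrow> real \<Rightarrow> (real^2) measure" where
  "uniform_cell L \<Phi> = scale_measure (ennreal (\<Phi> / L\<^sup>2)) (restrict_space lborel (cell L))"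

end

theory Submission imports Defs begin

text \<open>
  The energy has two parts, up to the factor \<open>1 / L\<^sup>2\<close>: the integral \<open>a\<close> over the height of the sums
  of square roots of the atoms of a slice (weighted by a constant at least \<open>1\<close>), and the transport
  cost \<open>b\<close>, the integral of \<open>\<bar>v\<bar>\<^sup>2\<close> against \<open>\<mu>\<close>.

  Every slice has mass \<open>\<Phi>\<close>, by the continuity equation, and the sum of the roots of numbers with
  sum \<open>\<Phi>\<close> is at least \<open>sqrt \<Phi>\<close>. Hence \<open>a \<ge> 2 * T * sqrt \<Phi>\<close>, which is the first term of the bound.

  The second term expresses a competition. The heights fill an interval of length \<open>2 * T\<close>, so some
  slice has a sum of roots at most \<open>p = a / T\<close>. Atoms much smaller than \<open>(\<Phi> / p)\<^sup>2\<close> carry little of the mass of that slice,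
  so half of its mass sits on \<open>N \<le> 2 * p\<^sup>2 / \<Phi>\<close> points (\<open>few_atoms_carry_half\<close>). On the other hand
  the trace at the top is uniform, and discs of a radius \<open>r\<close> with \<open>r\<^sup>2\<close> of order \<open>L\<^sup>2 / N\<close>
  around these points carry only a small part of it. A function concentrated on these discs, with
  gradient of order \<open>1/r\<close>, has integrals against the slice and against the trace that differ by a
  multiple of \<open>\<Phi>\<close> (\<open>concentrating_function\<close>). Along the height such an integral changes by at
  most its flux, which the Cauchy--Schwarz inequality bounds by \<open>(1/r) * sqrt (2 * T * \<Phi> * b)\<close>
  up to a constant (\<open>slice_integral_variation\<close>). Therefore \<open>\<Phi> * L\<^sup>2\<close> is at most of order \<open>T * N * b\<close>
  (\<open>transport_cost\<close>), that is, \<open>a\<^sup>2 * b\<close> is at least of order \<open>\<Phi>\<^sup>2 * L\<^sup>2 * T\<close>, and the cube root of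
  this quantity bounds \<open>a + b\<close> from below (\<open>interpolation\<close>).

  The equation is tested with smooth functions only. The concentrating function is therefore built
  from explicit smooth periodic peaks, and the integrals over slices are compared through smooth
  steps in the height. The energy, the traces and the atomicity of the slices refer to slicings
  that agree almost everywhere (\<open>slicing_AE_unique\<close>).
\<close>

section \<open>Smooth functions\<close>

lemma Ck_SucI:
  assumes "\<And>x. (f has_derivative f' x) (at x)" "\<And>b. b \<in> Basis \<Longrightarrow> Ck n (\<lambda>x. f' x b)"
  shows "Ck (Suc n) f"
proof -
  have "frechet_derivative f (at x) = f' x" for x
    using frechet_derivative_at[OF assms(1)] by simp
  then show ?thesis using assms by (auto simp: differentiable_def)
qed

lemma Ck_SucD:
  assumes "Ck (Suc n) f"
  shows "(f has_derivative frechet_derivative f (at x)) (at x)"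
    and "b \<in> Basis \<Longrightarrow> Ck n (\<lambda>x. frechet_derivative f (at x) b)"
  using assms by (auto simp: frechet_derivative_works)

lemma Ck_pred: "Ck (Suc n) f \<Longrightarrow> Ck n f"
proof (induction n arbitrary: f)
  case 0
  then show ?case by (auto intro!: continuous_at_imp_continuous_on differentiable_imp_continuous_within)
next
  case (Suc n)
  then show ?case using Ck.simps(2) by blast
qed

lemma Ck_const: "Ck n (\<lambda>_. c)"
proof (induction n arbitrary: c)
  case (Suc n)
  then show ?case by (auto intro!: Ck_SucI[where f' = "\<lambda>_ _. 0"] derivative_intros)
qed auto

lemma Ck_add: "Ck n f \<Longrightarrow> Ck n g \<Longrightarrow> Ck n (\<lambda>x. f x + g x)"
proof (induction n arbitrary: f g)
  case (Suc n)
  show ?case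
    by (rule Ck_SucI[OF has_derivative_add[OF Ck_SucD(1) Ck_SucD(1)]])
       (use Suc in \<open>auto intro!: Suc.IH\<close>)
qed (auto intro: continuous_intros)

lemma Ck_mult: "Ck n f \<Longrightarrow> Ck n g \<Longrightarrow> Ck n (\<lambda>x. f x * g x)"
proof (induction n arbitrary: f g)
  case (Suc n)
  show ?case
  proof (rule Ck_SucI[OF has_derivative_mult[OF Ck_SucD(1)[OF Suc.prems(1)] Ck_SucD(1)[OF Suc.prems(2)]]])
    fix b :: 'a assume "b \<in> Basis"
    then show "Ck n (\<lambda>x. f x * frechet_derivative g (at x) b + frechet_derivative f (at x) b * g x)"
      by (intro Ck_add Suc.IH Ck_pred[OF Suc.prems(1)] Ck_pred[OF Suc.prems(2)]
            Ck_SucD(2)[OF Suc.prems(1)] Ck_SucD(2)[OF Suc.prems(2)])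
  qed
qed (auto intro: continuous_intros)

lemma Ck_sum: "(\<And>i. i \<in> I \<Longrightarrow> Ck n (f i)) \<Longrightarrow> Ck n (\<lambda>x. \<Sum>i\<in>I. f i x)"
  by (induction I rule: infinite_finite_induct) (auto intro: Ck_const Ck_add)

lemma Ck_minus: "Ck n f \<Longrightarrow> Ck n g \<Longrightarrow> Ck n (\<lambda>x. f x - g x)"
  using Ck_add[of n f "\<lambda>x. (-1) * g x"] Ck_mult[OF Ck_const, of n g "-1"] by simp

lemma Ck_inverse:
  assumes "\<And>x. f x \<noteq> 0"
  shows "Ck n f \<Longrightarrow> Ck n (\<lambda>x. inverse (f x))"
proof (induction n)
  case 0
  then show ?case using assms by (auto intro!: continuous_intros)
next
  case (Suc n)
  show ?case
  proof (rule Ck_SucI)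
    show "((\<lambda>x. inverse (f x)) has_derivative
            (\<lambda>h. - (inverse (f x) * frechet_derivative f (at x) h * inverse (f x)))) (at x)" for x
      by (rule Deriv.has_derivative_inverse[OF assms Ck_SucD(1)[OF Suc.prems]])
    fix b :: 'a assume "b \<in> Basis"
    then have "Ck n (\<lambda>x. (-1) * (inverse (f x) * frechet_derivative f (at x) b * inverse (f x)))"
      by (intro Ck_mult Ck_const Suc.IH Ck_pred[OF Suc.prems] Ck_SucD(2)[OF Suc.prems])
    then show "Ck n (\<lambda>x. - (inverse (f x) * frechet_derivative f (at x) b * inverse (f x)))"
      by simp
  qed
qed

lemma Ck_affine:
  fixes l :: "'a::euclidean_space \<Rightarrow> 'b::euclidean_space"
  assumes l: "bounded_linear l"
  shows "Ck n f \<Longrightarrow> Ck n (\<lambda>x. f (l x + c))"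
proof (induction n arbitrary: f)
  case 0
  have "continuous_on UNIV (\<lambda>x. l x + c)"
    by (intro continuous_intros bounded_linear.continuous_on[OF l])
  with 0 show ?case
    using continuous_on_compose2[of UNIV f UNIV "\<lambda>x. l x + c"] by simp
next
  case (Suc n)
  let ?D = "\<lambda>x. frechet_derivative f (at x)"
  have lin: "linear (?D x)" for x
    by (rule has_derivative_linear[OF Ck_SucD(1)[OF Suc.prems]])
  show ?case
  proof (rule Ck_SucI)
    have "((\<lambda>x. l x + c) has_derivative l) (at x)" for x
      using has_derivative_add_const[OF bounded_linear_imp_has_derivative[OF l]] .
    then show "((\<lambda>x. f (l x + c)) has_derivative (\<lambda>h. ?D (l x + c) (l h))) (at x)" for x
      by (rule has_derivative_compose) (rule Ck_SucD(1)[OF Suc.prems])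
    fix b :: 'a assume b: "b \<in> Basis"
    have "?D y (l b) = (\<Sum>e\<in>Basis. (l b \<bullet> e) * ?D y e)" for y
      using linear_sum[OF lin, of y "\<lambda>e. (l b \<bullet> e) *\<^sub>R e" Basis] linear_scale[OF lin]
      by (simp add: euclidean_representation)
    moreover have "Ck n (\<lambda>x. ?D (l x + c) e)" if "e \<in> Basis" for e
      by (rule Suc.IH[where f = "\<lambda>y. ?D y e"]) (rule Ck_SucD(2)[OF Suc.prems that])
    then have "Ck n (\<lambda>x. \<Sum>e\<in>Basis. (l b \<bullet> e) * ?D (l x + c) e)"
      by (intro Ck_sum Ck_mult Ck_const)
    ultimately show "Ck n (\<lambda>x. ?D (l x + c) (l b))" by simp
  qed
qed

lemma Ck_SucI_real:
  fixes f :: "real \<Rightarrow> real"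
  assumes "\<And>x. (f has_real_derivative f' x) (at x)" "Ck n f'"
  shows "Ck (Suc n) f"
  using assms by (intro Ck_SucI[where f' = "\<lambda>x. (*) (f' x)"]) (auto simp: has_field_derivative_def)

lemma Ck_sin_cos: "Ck n (\<lambda>x::real. sin x) \<and> Ck n (\<lambda>x::real. cos x)"
proof (induction n)
  case 0
  then show ?case by (auto intro: continuous_intros)
next
  case (Suc n)
  then have "Ck n (\<lambda>x::real. (-1) * sin x)" by (intro Ck_mult Ck_const) auto
  then show ?case using Suc by (auto intro!: Ck_SucI_real derivative_eq_intros simp del: Ck.simps)
qed

text \<open>
  The powers of \<open>x\<close> in the denominator make the family closed under differentiation up to linear
  combinations, so that smoothness of all members follows by one induction.
\<close>

definition flat :: "nat \<Rightarrow> real \<Rightarrow> real" where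
  "flat k x = (if x > 0 then exp (- (1 / x)) / x ^ k else 0)"

lemma flat_tendsto_0: "(flat k \<longlongrightarrow> 0) (at 0)"
proof -
  have 1: "((\<lambda>y. y ^ k / exp y) \<longlongrightarrow> (0::real)) at_top" by (rule tendsto_power_div_exp_0)
  have "((\<lambda>x. inverse x ^ k / exp (inverse x)) \<longlongrightarrow> (0::real)) (at_right 0)"
    by (rule filterlim_compose[OF 1 filterlim_inverse_at_top_right])
  then have "(flat k \<longlongrightarrow> 0) (at_right 0)"
    by (rule Lim_transform_eventually)
       (auto simp: eventually_at_filter flat_def exp_minus field_simps)
  moreover have "(flat k \<longlongrightarrow> 0) (at_left 0)"
    by (rule Lim_transform_eventually[OF tendsto_const]) (auto simp: eventually_at_filter flat_def)
  ultimately show ?thesis by (simp add: filterlim_split_at)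
qed

lemma flat_has_derivative:
  "(flat k has_real_derivative (flat (k + 2) x - of_nat k * flat (k + 1) x)) (at x)"
proof (cases x "0::real" rule: linorder_cases)
  case less
  have "((\<lambda>_. 0) has_real_derivative 0) (at x)" by simp
  then have "(flat k has_real_derivative 0) (at x)"
    by (rule has_field_derivative_transform_within_open[of _ _ _ "{..<0}"])
       (use less in \<open>auto simp: flat_def\<close>)
  then show ?thesis using less by (simp add: flat_def)
next
  case equal
  have "((\<lambda>h. flat k h / h) \<longlongrightarrow> 0) (at 0)"
    by (rule Lim_transform_eventually[OF flat_tendsto_0[of "Suc k"]])
       (auto simp: eventually_at_filter flat_def)
  then show ?thesis using equal by (simp add: DERIV_def flat_def)
next
  case greater
  have "((\<lambda>x. exp (- (1 / x)) / x ^ k) has_real_derivative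
          flat (k + 2) x - of_nat k * flat (k + 1) x) (at x)"
    using greater
    apply (auto intro!: derivative_eq_intros simp: flat_def)
    apply (cases k)
     apply (auto simp: field_simps power2_eq_square)
    done
  then show ?thesis
    by (rule has_field_derivative_transform_within_open[of _ _ _ "{0<..}"])
       (use greater in \<open>auto simp: flat_def\<close>)
qed

lemma Ck_flat: "Ck n (flat k)"
proof (induction n arbitrary: k)
  case 0
  show ?case
    using DERIV_isCont[OF flat_has_derivative] by (auto intro!: continuous_at_imp_continuous_on)
next
  case (Suc n)
  show ?case
    by (rule Ck_SucI_real[OF flat_has_derivative]) (intro Ck_minus Ck_mult Ck_const Suc.IH)
qed

text \<open>
  The quotient \<open>u / (u + w)\<close> of flat functions rising from \<open>0\<close> at \<open>c\<close> and falling to \<open>0\<close> at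
  \<open>c + \<epsilon>\<close>; the denominator never vanishes because the two half-lines overlap.
\<close>

lemma smooth_step:
  fixes c \<epsilon> :: real
  assumes "\<epsilon> > 0"
  obtains f f' where "\<And>n. Ck n f" "\<And>t. (f has_real_derivative f' t) (at t)"
    "continuous_on UNIV f'"
    "\<And>t. f t \<in> {0..1}" "\<And>t. t \<le> c \<Longrightarrow> f t = 0" "\<And>t. t \<ge> c + \<epsilon> \<Longrightarrow> f t = 1"
    "\<And>t. f' t \<ge> 0" "\<And>t. t \<notin> {c..c + \<epsilon>} \<Longrightarrow> f' t = 0"
proof -
  define u where "u t = flat 0 (t / \<epsilon> + - c / \<epsilon>)" for t
  define w where "w t = flat 0 (- (t / \<epsilon>) + (1 + c / \<epsilon>))" for t
  define u' where "u' t = flat 2 (t / \<epsilon> + - c / \<epsilon>) / \<epsilon>" for t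
  define w' where "w' t = - flat 2 (- (t / \<epsilon>) + (1 + c / \<epsilon>)) / \<epsilon>" for t
  have l: "bounded_linear (\<lambda>t. t / \<epsilon>)" "bounded_linear (\<lambda>t. - (t / \<epsilon>))"
    by (rule bounded_linear_divide, rule bounded_linear_minus[OF bounded_linear_divide])
  have Ck: "Ck n u" "Ck n w" for n
    unfolding u_def w_def by (rule Ck_affine[OF l(1) Ck_flat] Ck_affine[OF l(2) Ck_flat])+
  have f0: "(flat 0 has_real_derivative flat 2 x) (at x)" for x
    using flat_has_derivative[of 0 x] by (simp add: numeral_2_eq_2)
  have D: "(u has_real_derivative u' t) (at t)" "(w has_real_derivative w' t) (at t)" for t
  proof -
    have "((\<lambda>t. t / \<epsilon> + - c / \<epsilon>) has_real_derivative 1 / \<epsilon>) (at t)"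
      "((\<lambda>t. - (t / \<epsilon>) + (1 + c / \<epsilon>)) has_real_derivative - (1 / \<epsilon>)) (at t)"
      using assms by (auto intro!: derivative_eq_intros)
    from this[THEN DERIV_chain2[OF f0]]
    show "(u has_real_derivative u' t) (at t)" "(w has_real_derivative w' t) (at t)"
      by (simp_all add: u_def[abs_def] w_def[abs_def] u'_def w'_def)
  qed
  have nn: "u t \<ge> 0" "w t \<ge> 0" "u' t \<ge> 0" "w' t \<le> 0" for t
    using assms by (auto simp: u_def w_def u'_def w'_def flat_def)
  have "t / \<epsilon> + - c / \<epsilon> = (t - c) / \<epsilon>"
    "- (t / \<epsilon>) + (1 + c / \<epsilon>) = (c + \<epsilon> - t) / \<epsilon>" for t
    using assms by (simp_all add: field_simps)
  then have arg: "t / \<epsilon> + - c / \<epsilon> \<le> 0 \<longleftrightarrow> t \<le> c" "- (t / \<epsilon>) + (1 + c / \<epsilon>) \<le> 0 \<longleftrightarrow> t \<ge> c + \<epsilon>" for t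
    using assms by (simp_all add: divide_le_0_iff)
  have z: "t \<le> c \<Longrightarrow> u t = 0" "t \<le> c \<Longrightarrow> u' t = 0" "t \<ge> c + \<epsilon> \<Longrightarrow> w t = 0" "t \<ge> c + \<epsilon> \<Longrightarrow> w' t = 0" for t
    using arg[of t] by (auto simp: u_def w_def u'_def w'_def flat_def)
  have p: "t > c \<Longrightarrow> u t > 0" "t < c + \<epsilon> \<Longrightarrow> w t > 0" for t
    using arg[of t] by (auto simp: u_def w_def flat_def)
  have pos: "u t + w t > 0" for t
    using p[of t] nn[of t] assms by (cases "t > c") (auto intro: add_pos_nonneg add_nonneg_pos)
  define f where "f t = u t * inverse (u t + w t)" for t
  define f' where "f' t = (u' t * w t - u t * w' t) / (u t + w t)^2" for t
  show thesis
  proof (rule that[of f f'])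
    show "Ck n f" for n
      unfolding f_def using pos by (intro Ck_mult Ck_inverse Ck_add Ck) (metis less_irrefl)
    show Df: "(f has_real_derivative f' t) (at t)" for t
      unfolding f_def f'_def using pos[of t]
      by (auto intro!: derivative_eq_intros D simp: field_simps power2_eq_square)
    have cont: "continuous_on UNIV (flat k)" for k
      using Ck_flat[of 0 k] by simp
    have "continuous_on UNIV u" "continuous_on UNIV w"
      using Ck[of 0] by auto
    moreover have "continuous_on UNIV u'" "continuous_on UNIV w'"
      unfolding u'_def w'_def using assms
      by (intro continuous_intros continuous_on_compose2[OF cont]; simp)+
    ultimately show "continuous_on UNIV f'"
      unfolding f'_def using pos by (intro continuous_intros) (auto simp: less_imp_neq[symmetric])
    show "f t \<in> {0..1}" for t
      using pos[of t] nn[of t] by (auto simp: f_def field_simps)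
    show "t \<le> c \<Longrightarrow> f t = 0" for t using z by (simp add: f_def)
    show "t \<ge> c + \<epsilon> \<Longrightarrow> f t = 1" for t using z[of t] pos[of t] by (simp add: f_def)
    show "f' t \<ge> 0" for t
    proof -
      have "u t * w' t \<le> 0" "0 \<le> u' t * w t"
        using nn[of t] by (simp_all add: mult_nonneg_nonpos)
      then show ?thesis unfolding f'_def by (intro divide_nonneg_nonneg) auto
    qed
    show "t \<notin> {c..c + \<epsilon>} \<Longrightarrow> f' t = 0" for t
      using z[of t] by (cases "t \<le> c") (auto simp: f'_def)
  qed
qed

section \<open>Slicings\<close>

lemma cell_borel [measurable]: "cell L \<in> sets borel"
proof -
  have "cell L = (\<Inter>i. {x. - L / 2 \<le> x $ i \<and> x $ i < L / 2})"
    by (auto simp: cell_def)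
  also have "\<dots> \<in> sets borel"
  proof (intro sets.finite_INT)
    show "{x. - L / 2 \<le> x $ i \<and> x $ i < L / 2} \<in> sets borel" for i :: 2
      unfolding cart_eq_inner_axis by measurable
  qed auto
  finally show ?thesis .
qed

lemma cyl_borel [measurable]: "cyl L T \<in> sets borel"
  unfolding cyl_def borel_prod[symmetric] by (intro pair_measureI) auto

lemma finite_measures_onD:
  assumes "\<sigma> \<in> finite_measures_on X" "X \<in> sets borel"
  shows "finite_measure \<sigma>" "sets \<sigma> = sets (restrict_space borel X)" "space \<sigma> = X"
    "A \<in> sets \<sigma> \<longleftrightarrow> A \<subseteq> X \<and> A \<in> sets borel"
proof -
  show *: "finite_measure \<sigma>" "sets \<sigma> = sets (restrict_space borel X)"
    using assms by (auto simp: finite_measures_on_def)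
  show "space \<sigma> = X"
    using sets_eq_imp_space_eq[OF *(2)] by (simp add: space_restrict_space)
  show "A \<in> sets \<sigma> \<longleftrightarrow> A \<subseteq> X \<and> A \<in> sets borel"
    using assms(2) by (simp add: *(2) sets_restrict_space_iff)
qed

locale sliced_measure =
  fixes L T :: real and \<mu> :: "((real^2) \<times> real) measure" and \<nu> :: "real \<Rightarrow> (real^2) measure"
  assumes fin: "\<mu> \<in> finite_measures_on (cyl L T)"
    and slc: "slicing L T \<mu> \<nu>"
begin

abbreviation "I \<equiv> {-T<..<T}"

lemma sets_mu [measurable_cong]: "sets \<mu> = sets (restrict_space borel (cyl L T))"
  using finite_measures_onD[OF fin] by simp

lemma space_mu: "space \<mu> = cyl L T"
  using finite_measures_onD[OF fin] by simp

lemma borel_mu: "f \<in> borel_measurable borel \<Longrightarrow> f \<in> borel_measurable \<mu>"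
  by (simp add: measurable_cong_sets[OF sets_mu refl] measurable_restrict_space1)

lemma measurable_fst_mu [measurable]: "fst \<in> borel_measurable \<mu>"
  and measurable_snd_mu [measurable]: "snd \<in> borel_measurable \<mu>"
  by (auto intro!: borel_mu borel_measurable_continuous_onI continuous_intros)

lemma slice_fin: "t \<in> I \<Longrightarrow> \<nu> t \<in> finite_measures_on (cell L)"
  using slc by (auto simp: slicing_def)

lemma
  assumes "t \<in> I"
  shows slice_finite: "finite_measure (\<nu> t)"
    and sets_slice: "sets (\<nu> t) = sets (restrict_space borel (cell L))"
    and space_slice: "space (\<nu> t) = cell L"
  using finite_measures_onD[OF slice_fin[OF assms]] by auto

lemma borel_slice: "t \<in> I \<Longrightarrow> f \<in> borel_measurable borel \<Longrightarrow> f \<in> borel_measurable (\<nu> t)"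
  by (simp add: measurable_cong_sets[OF sets_slice refl] measurable_restrict_space1)

lemma emeasure_rectangle:
  assumes B: "B \<in> sets borel" and D: "D \<in> sets borel"
  shows "emeasure \<mu> ((B \<inter> cell L) \<times> (D \<inter> I)) =
      (\<integral>\<^sup>+t. emeasure (\<nu> t) (B \<inter> cell L) * indicator I t * indicator D t \<partial>lborel)"
proof -
  have "(B \<inter> cell L) \<times> (D \<inter> I) \<in> sets \<mu>"
    using B D by (auto simp: sets_mu sets_restrict_space_iff cyl_def borel_prod[symmetric])
  then have "emeasure \<mu> ((B \<inter> cell L) \<times> (D \<inter> I)) =
      (\<integral>\<^sup>+t\<in>I. emeasure (\<nu> t) {x. (x, t) \<in> (B \<inter> cell L) \<times> (D \<inter> I)} \<partial>lborel)"
    using slc by (auto simp: slicing_def)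
  also have "\<dots> = (\<integral>\<^sup>+t. emeasure (\<nu> t) (B \<inter> cell L) * indicator I t * indicator D t \<partial>lborel)"
    by (intro nn_integral_cong) (auto simp: indicator_def intro!: arg_cong[where f = "emeasure _"])
  finally show ?thesis .
qed

lemma measurable_slice:
  assumes "B \<in> sets borel"
  shows "(\<lambda>t. emeasure (\<nu> t) (B \<inter> cell L) * indicator I t) \<in> borel_measurable borel"
proof -
  have "B \<inter> cell L \<in> sets (restrict_space borel (cell L))"
    using assms by (auto simp: sets_restrict_space_iff)
  then show ?thesis
    using slc by (subst borel_measurable_restrict_space_iff_ennreal[symmetric])
      (auto simp: slicing_def)
qed

lemma nn_integral_indicator_slicing:
  assumes [measurable]: "B \<in> sets borel" "\<rho> \<in> borel_measurable borel"
  shows "(\<integral>\<^sup>+p. indicator B (fst p) * \<rho> (snd p) \<partial>\<mu>) =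
    (\<integral>\<^sup>+t. \<rho> t * (emeasure (\<nu> t) (B \<inter> cell L) * indicator I t) \<partial>lborel)"
proof -
  let ?M = "distr (density \<mu> (\<lambda>p. indicator B (fst p))) borel snd"
  let ?N = "density lborel (\<lambda>t. emeasure (\<nu> t) (B \<inter> cell L) * indicator I t)"
  note [measurable] = measurable_slice[OF assms(1)]
  have "?M = ?N"
  proof (rule measure_eqI)
    fix D assume "D \<in> sets ?M"
    then have D[measurable]: "D \<in> sets borel" by simp
    have "emeasure ?M D = emeasure (density \<mu> (\<lambda>p. indicator B (fst p))) (snd -` D \<inter> space \<mu>)"
      by (subst emeasure_distr) auto
    also have "\<dots> = (\<integral>\<^sup>+p. indicator B (fst p) * indicator (snd -` D \<inter> space \<mu>) p \<partial>\<mu>)"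
      by (subst emeasure_density) auto
    also have "\<dots> = (\<integral>\<^sup>+p. indicator ((B \<inter> cell L) \<times> (D \<inter> I)) p \<partial>\<mu>)"
      by (intro nn_integral_cong) (auto simp: space_mu cyl_def indicator_def)
    also have "\<dots> = emeasure \<mu> ((B \<inter> cell L) \<times> (D \<inter> I))"
      using assms D
      by (subst nn_integral_indicator)
         (auto simp: sets_mu sets_restrict_space_iff cyl_def borel_prod[symmetric])
    also have "\<dots> = emeasure ?N D"
      by (simp add: emeasure_rectangle emeasure_density)
    finally show "emeasure ?M D = emeasure ?N D" .
  qed simp
  then have "nn_integral ?M \<rho> = nn_integral ?N \<rho>" by simp
  moreover have "nn_integral ?M \<rho> = (\<integral>\<^sup>+p. indicator B (fst p) * \<rho> (snd p) \<partial>\<mu>)"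
    by (simp add: nn_integral_distr nn_integral_density)
  moreover have "nn_integral ?N \<rho> =
      (\<integral>\<^sup>+t. \<rho> t * (emeasure (\<nu> t) (B \<inter> cell L) * indicator I t) \<partial>lborel)"
    using measurable_slice[OF assms(1)] by (subst nn_integral_density) (simp_all only:
        measurable_lborel1 measurable_lborel2 assms(2) mult.commute)
  ultimately show ?thesis by simp
qed

text \<open>
  Only products of a function of \<open>x'\<close> and a function of \<open>x\<^sub>3\<close> are integrated slice by slice; for
  these it suffices to vary the first factor, since for a fixed indicator \<open>indicator B x'\<close> both
  sides are integrals against a measure in \<open>x\<^sub>3\<close>.
\<close>

lemma
  fixes \<psi> :: "real^2 \<Rightarrow> ennreal"
  assumes \<psi>: "\<psi> \<in> borel_measurable borel"
  shows measurable_slice_integral: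
      "(\<lambda>t. (\<integral>\<^sup>+x. \<psi> x \<partial>\<nu> t) * indicator I t) \<in> borel_measurable borel" (is "?m \<psi>")
    and nn_integral_slicing: "\<rho> \<in> borel_measurable borel \<Longrightarrow>
      (\<integral>\<^sup>+p. \<psi> (fst p) * \<rho> (snd p) \<partial>\<mu>) =
      (\<integral>\<^sup>+t. \<rho> t * ((\<integral>\<^sup>+x. \<psi> x \<partial>\<nu> t) * indicator I t) \<partial>lborel)"
proof -
  have "?m \<psi> \<and> (\<forall>\<rho>\<in>borel_measurable borel. (\<integral>\<^sup>+p. \<psi> (fst p) * \<rho> (snd p) \<partial>\<mu>) =
      (\<integral>\<^sup>+t. \<rho> t * ((\<integral>\<^sup>+x. \<psi> x \<partial>\<nu> t) * indicator I t) \<partial>lborel))"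
    using \<psi>
  proof (induction rule: borel_measurable_induct)
    case (cong f g)
    then have "f = g" by auto
    then show ?case using cong by simp
  next
    case (set B)
    have *: "(\<integral>\<^sup>+x. indicator B x \<partial>\<nu> t) * indicator I t = emeasure (\<nu> t) (B \<inter> cell L) * indicator I t"
      for t
    proof (cases "t \<in> I")
      case True
      have "(\<integral>\<^sup>+x. indicator B x \<partial>\<nu> t) = (\<integral>\<^sup>+x. indicator (B \<inter> cell L) x \<partial>\<nu> t)"
        by (intro nn_integral_cong) (auto simp: space_slice[OF True] indicator_def)
      then show ?thesis
        using set by (simp add: sets_slice[OF True] sets_restrict_space_iff)
    qed simp
    show ?case
      unfolding * using set measurable_slice nn_integral_indicator_slicing by auto
  next
    case (mult u c)
    have *: "(\<integral>\<^sup>+x. c * u x \<partial>\<nu> t) * indicator I t = c * ((\<integral>\<^sup>+x. u x \<partial>\<nu> t) * indicator I t)" for t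
      using borel_slice[of t u] mult.hyps by (cases "t \<in> I") (auto simp: nn_integral_cmult)
    note [measurable] = mult.hyps mult.IH[THEN conjunct1]
    show ?case
    proof (intro conjI ballI)
      fix \<rho> :: "real \<Rightarrow> ennreal" assume \<rho>[measurable]: "\<rho> \<in> borel_measurable borel"
      have "(\<integral>\<^sup>+p. c * u (fst p) * \<rho> (snd p) \<partial>\<mu>) = c * (\<integral>\<^sup>+p. u (fst p) * \<rho> (snd p) \<partial>\<mu>)"
        by (simp add: nn_integral_cmult mult.assoc)
      also have "\<dots> = c * (\<integral>\<^sup>+t. \<rho> t * ((\<integral>\<^sup>+x. u x \<partial>\<nu> t) * indicator I t) \<partial>lborel)"
        using mult.IH \<rho> by simp
      also have "\<dots> = (\<integral>\<^sup>+t. \<rho> t * (c * ((\<integral>\<^sup>+x. u x \<partial>\<nu> t) * indicator I t)) \<partial>lborel)"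
        by (subst nn_integral_cmult[symmetric]) (auto simp: mult.left_commute)
      finally show "(\<integral>\<^sup>+p. c * u (fst p) * \<rho> (snd p) \<partial>\<mu>) =
        (\<integral>\<^sup>+t. \<rho> t * ((\<integral>\<^sup>+x. c * u x \<partial>\<nu> t) * indicator I t) \<partial>lborel)" by (simp add: *)
    qed (simp add: *)
  next
    case (add u v)
    have *: "(\<integral>\<^sup>+x. v x + u x \<partial>\<nu> t) * indicator I t =
        (\<integral>\<^sup>+x. v x \<partial>\<nu> t) * indicator I t + (\<integral>\<^sup>+x. u x \<partial>\<nu> t) * indicator I t" for t
      using borel_slice[of t u] borel_slice[of t v] add.hyps
      by (cases "t \<in> I") (auto simp: nn_integral_add)
    note [measurable] = add.hyps add.IH[THEN conjunct1]
    show ?case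
      using add.IH by (auto simp: * distrib_left distrib_right nn_integral_add)
  next
    case (seq U)
    have *: "(\<integral>\<^sup>+x. (SUP i. U i) x \<partial>\<nu> t) * indicator I t =
        (SUP i. (\<integral>\<^sup>+x. U i x \<partial>\<nu> t) * indicator I t)" for t
    proof (cases "t \<in> I")
      case True
      have "(\<integral>\<^sup>+x. (SUP i. U i x) \<partial>\<nu> t) = (SUP i. \<integral>\<^sup>+x. U i x \<partial>\<nu> t)"
        using seq.hyps by (intro nn_integral_monotone_convergence_SUP borel_slice[OF True])
      then show ?thesis using True by (simp add: image_comp)
    qed simp
    note [measurable] = seq.hyps(1) seq.IH[THEN conjunct1]
    have incU: "incseq (\<lambda>i. (\<integral>\<^sup>+x. U i x \<partial>\<nu> t) * indicator I t)" for t
      using seq.hyps by (auto simp: incseq_def le_fun_def intro!: mult_right_mono nn_integral_mono)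
    show ?case
    proof (intro conjI ballI)
      fix \<rho> :: "real \<Rightarrow> ennreal" assume \<rho>[measurable]: "\<rho> \<in> borel_measurable borel"
      have "(\<integral>\<^sup>+p. (SUP i. U i) (fst p) * \<rho> (snd p) \<partial>\<mu>) =
          (\<integral>\<^sup>+p. (SUP i. U i (fst p) * \<rho> (snd p)) \<partial>\<mu>)"
        by (simp add: SUP_mult_right_ennreal image_comp)
      also have "\<dots> = (SUP i. \<integral>\<^sup>+p. U i (fst p) * \<rho> (snd p) \<partial>\<mu>)"
        using seq.hyps
        by (intro nn_integral_monotone_convergence_SUP)
           (auto simp: incseq_def le_fun_def intro!: mult_right_mono)
      also have "\<dots> = (SUP i. \<integral>\<^sup>+t. \<rho> t * ((\<integral>\<^sup>+x. U i x \<partial>\<nu> t) * indicator I t) \<partial>lborel)"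
        using seq.IH \<rho> by simp
      also have "\<dots> = (\<integral>\<^sup>+t. (SUP i. \<rho> t * ((\<integral>\<^sup>+x. U i x \<partial>\<nu> t) * indicator I t)) \<partial>lborel)"
        using incU
        by (intro nn_integral_monotone_convergence_SUP[symmetric])
           (auto simp: incseq_def le_fun_def intro!: mult_left_mono)
      finally show "(\<integral>\<^sup>+p. (SUP i. U i) (fst p) * \<rho> (snd p) \<partial>\<mu>) =
          (\<integral>\<^sup>+t. \<rho> t * ((\<integral>\<^sup>+x. (SUP i. U i) x \<partial>\<nu> t) * indicator I t) \<partial>lborel)"
        unfolding * by (simp add: SUP_mult_left_ennreal)
    qed (unfold *, measurable)
  qed
  then show "?m \<psi>" "\<rho> \<in> borel_measurable borel \<Longrightarrow>
      (\<integral>\<^sup>+p. \<psi> (fst p) * \<rho> (snd p) \<partial>\<mu>) =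
      (\<integral>\<^sup>+t. \<rho> t * ((\<integral>\<^sup>+x. \<psi> x \<partial>\<nu> t) * indicator I t) \<partial>lborel)" by auto
qed

end

text \<open>
  For a fixed Borel set the masses of the slices are the density of a measure in \<open>x\<^sub>3\<close> that is
  determined by \<open>\<mu>\<close>, hence determined almost everywhere. Countably many sets that generate the
  Borel sets and are stable under intersection determine each slice.
\<close>

lemma slicing_AE_unique:
  assumes fin: "\<mu> \<in> finite_measures_on (cyl L T)"
    and "slicing L T \<mu> \<nu>" "slicing L T \<mu> \<nu>'"
  shows "AE t in lborel. t \<in> {-T<..<T} \<longrightarrow> \<nu> t = \<nu>' t"
proof -
  interpret a: sliced_measure L T \<mu> \<nu> by unfold_locales fact+
  interpret b: sliced_measure L T \<mu> \<nu>' by unfold_locales fact+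
  obtain B :: "(real^2) set set" where B: "countable B" "topological_basis B"
    using ex_countable_basis by auto
  define E where "E = Inter ` {F. finite F \<and> F \<subseteq> B}"
  have cE: "countable E"
    unfolding E_def using B(1) by (intro countable_image countable_Collect_finite_subset)
  have EI: "\<Inter>F \<in> E" if "finite F" "F \<subseteq> B" for F
    unfolding E_def by (rule imageI) (simp add: that)
  have EE: "\<exists>F. finite F \<and> F \<subseteq> B \<and> e = \<Inter>F" if "e \<in> E" for e
    using that unfolding E_def by (elim imageE CollectE conjE) (intro exI conjI)
  have BE: "B \<subseteq> E"
  proof
    fix b assume "b \<in> B"
    then show "b \<in> E" using EI[of "{b}"] by simp
  qed
  have openE: "open e" if e: "e \<in> E" for e
  proof -
    obtain F where F: "finite F" "F \<subseteq> B" "e = \<Inter>F" using EE[OF e] by metis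
    have "open X" if "X \<in> F" for X
      using topological_basis_open[OF B(2) subsetD[OF F(2) that]] .
    then show ?thesis using F open_Inter[of F] by simp
  qed
  have "\<exists>E'\<subseteq>E. \<Union>E' = X" if "open X" for X
  proof -
    have "\<exists>B'\<subseteq>B. \<Union>B' = X"
      using conjunct2[OF B(2)[unfolded topological_basis_def]] that by simp
    then show ?thesis using BE by (elim exE conjE) (intro exI conjI subset_trans[OF _ BE])
  qed
  then have "topological_basis E"
    using openE unfolding topological_basis_def by (intro conjI ballI allI impI)
  then have borelE: "sets (borel :: (real^2) measure) = sigma_sets UNIV E"
    by (subst borel_eq_countable_basis[OF cE]) (assumption, rule sets_measure_of, simp)
  have UE: "UNIV \<in> E" using EI[of "{}"] by simp
  have stable: "Int_stable E"
  proof (rule Int_stableI)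
    fix a b assume "a \<in> E" "b \<in> E"
    then obtain F G where "finite F" "F \<subseteq> B" "a = \<Inter>F" "finite G" "G \<subseteq> B" "b = \<Inter>G"
      using EE by metis
    then have "a \<inter> b = \<Inter>(F \<union> G)" "finite (F \<union> G)" "F \<union> G \<subseteq> B" by auto
    then show "a \<inter> b \<in> E" using EI[of "F \<union> G"] by simp
  qed
  have "AE t in lborel. emeasure (\<nu> t) (e \<inter> cell L) * indicator a.I t =
      emeasure (\<nu>' t) (e \<inter> cell L) * indicator a.I t" if "e \<in> E" for e
  proof (rule sigma_finite_measure.density_unique[OF sigma_finite_lborel])
    have e: "e \<in> sets borel" using openE[OF that] by auto
    then show m: "(\<lambda>t. emeasure (\<nu> t) (e \<inter> cell L) * indicator a.I t) \<in> borel_measurable lborel"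
      "(\<lambda>t. emeasure (\<nu>' t) (e \<inter> cell L) * indicator a.I t) \<in> borel_measurable lborel"
      using a.measurable_slice[OF e] b.measurable_slice[OF e] by simp_all
    show "density lborel (\<lambda>t. emeasure (\<nu> t) (e \<inter> cell L) * indicator a.I t) =
        density lborel (\<lambda>t. emeasure (\<nu>' t) (e \<inter> cell L) * indicator a.I t)"
    proof (rule measure_eqI)
      fix D assume "D \<in> sets (density lborel (\<lambda>t. emeasure (\<nu> t) (e \<inter> cell L) * indicator a.I t))"
      then have D: "D \<in> sets borel" by simp
      show "emeasure (density lborel (\<lambda>t. emeasure (\<nu> t) (e \<inter> cell L) * indicator a.I t)) D =
        emeasure (density lborel (\<lambda>t. emeasure (\<nu>' t) (e \<inter> cell L) * indicator a.I t)) D"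
        using m D a.emeasure_rectangle[OF e D] b.emeasure_rectangle[OF e D]
        by (simp add: emeasure_density)
    qed simp
  qed
  then have "AE t in lborel. \<forall>e\<in>E. emeasure (\<nu> t) (e \<inter> cell L) * indicator a.I t =
      emeasure (\<nu>' t) (e \<inter> cell L) * indicator a.I t"
    by (subst AE_ball_countable[OF cE]) simp
  then show ?thesis
  proof eventually_elim
    case (elim t)
    show ?case
    proof
      assume t: "t \<in> a.I"
      have em: "emeasure (distr (\<nu> t) borel (\<lambda>x. x)) A = emeasure (\<nu> t) (A \<inter> cell L)"
        "emeasure (distr (\<nu>' t) borel (\<lambda>x. x)) A = emeasure (\<nu>' t) (A \<inter> cell L)"
        if "A \<in> sets borel" for A
      proof -
        have "(\<lambda>x. x) \<in> \<nu> t \<rightarrow>\<^sub>M borel" "(\<lambda>x. x) \<in> \<nu>' t \<rightarrow>\<^sub>M borel"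
          by (rule a.borel_slice[OF t measurable_ident_sets[OF refl]],
              rule b.borel_slice[OF t measurable_ident_sets[OF refl]])
        from this[THEN emeasure_distr, OF that]
        show "emeasure (distr (\<nu> t) borel (\<lambda>x. x)) A = emeasure (\<nu> t) (A \<inter> cell L)"
          "emeasure (distr (\<nu>' t) borel (\<lambda>x. x)) A = emeasure (\<nu>' t) (A \<inter> cell L)"
          by (simp_all add: a.space_slice[OF t] b.space_slice[OF t])
      qed
      have D: "distr (\<nu> t) borel (\<lambda>x. x) = distr (\<nu>' t) borel (\<lambda>x. x)"
      proof (rule measure_eqI_generator_eq[OF stable, where \<Omega> = UNIV and A = "\<lambda>_. UNIV"])
        fix e assume e: "e \<in> E"
        have "e \<in> sets borel" using openE[OF e] by (rule borel_open)
        then show "emeasure (distr (\<nu> t) borel (\<lambda>x. x)) e = emeasure (distr (\<nu>' t) borel (\<lambda>x. x)) e"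
          using bspec[OF elim e] t by (simp add: em)
      next
        interpret finite_measure "\<nu> t" using a.slice_finite[OF t] .
        show "emeasure (distr (\<nu> t) borel (\<lambda>x. x)) UNIV \<noteq> \<infinity>" by (simp add: em)
      qed (simp_all add: UE borelE)
      show "\<nu> t = \<nu>' t"
      proof (rule measure_eqI)
        show "sets (\<nu> t) = sets (\<nu>' t)" using a.sets_slice[OF t] b.sets_slice[OF t] by simp
        fix A assume "A \<in> sets (\<nu> t)"
        then have A: "A \<in> sets borel" "A \<inter> cell L = A"
          by (auto simp: a.sets_slice[OF t] sets_restrict_space_iff)
        show "emeasure (\<nu> t) A = emeasure (\<nu>' t) A"
          using em[OF A(1)] A(2) D by simp
      qed
    qed
  qed
qed

section \<open>Variation of slice integrals\<close>

text \<open>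
  Testing the continuity equation with \<open>\<psi> x' * \<eta> x\<^sub>3\<close> turns the slice averages of \<open>\<psi>\<close> against \<open>\<eta>'\<close>
  into a flux integral, which the Cauchy--Schwarz inequality controls. The inequality is applied
  to the integrand \<open>grad' \<phi> \<bullet> v\<close> itself rather than to the density \<open>v = dm/d\<mu>\<close>: this integrand is
  measurable as soon as it is integrable, and otherwise its integral is \<open>0\<close>.
\<close>

lemma flux_estimate:
  fixes \<psi> :: "real^2 \<Rightarrow> real"
  assumes fin: "\<mu> \<in> finite_measures_on (cyl L T)" and m: "m \<in> fluxes L T \<mu>"
    and \<psi>: "\<And>n. Ck n \<psi>" "periodic L \<psi>"
    and C: "C \<ge> 0" "\<And>x. norm (\<chi> i. frechet_derivative \<psi> (at x) (axis i 1) :: real^2) \<le> C"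
    and \<eta>: "\<And>n. Ck n \<eta>" "\<And>t. (\<eta> has_real_derivative \<eta>' t) (at t)" "\<And>t. \<bar>\<eta> t\<bar> \<le> 1"
    and s: "s < T" "\<And>t. s \<le> \<bar>t\<bar> \<Longrightarrow> \<eta> t = 0"
  shows "ennreal ((\<integral>p. \<psi> (fst p) * \<eta>' (snd p) \<partial>\<mu>)\<^sup>2) \<le>
    ennreal (C\<^sup>2) * emeasure \<mu> (space \<mu>) * (\<integral>\<^sup>+p. ennreal ((norm (vector_RN_deriv \<mu> m p))\<^sup>2) \<partial>\<mu>)"
proof -
  define \<phi> where "\<phi> p = \<psi> (fst p) * \<eta> (snd p)" for p
  define v where "v = vector_RN_deriv \<mu> m"
  have Ck\<phi>: "Ck n \<phi>" for n
    unfolding \<phi>_def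
    using Ck_affine[OF bounded_linear_fst \<psi>(1)[of n], of 0] Ck_affine[OF bounded_linear_snd \<eta>(1)[of n], of 0]
    by (intro Ck_mult) simp_all
  have test: "test_function L T \<phi>"
    unfolding test_function_def
  proof (intro conjI allI)
    show "periodic L (\<lambda>x. \<phi> (x, t))" for t using \<psi>(2) by (auto simp: periodic_def \<phi>_def)
    show "\<exists>s<T. \<forall>x t. s \<le> \<bar>t\<bar> \<longrightarrow> \<phi> (x, t) = 0" using s by (auto simp: \<phi>_def)
  qed (rule Ck\<phi>)
  let ?D = "\<lambda>x. frechet_derivative \<psi> (at x)"
  have D\<psi>: "(\<psi> has_derivative ?D x) (at x)" for x
    using Ck_SucD(1)[OF \<psi>(1)] .
  have D0: "?D x 0 = 0" for x
    using linear_0[OF has_derivative_linear[OF D\<psi>]] .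
  have "(\<phi> has_derivative (\<lambda>h. \<psi> (fst p) * (\<eta>' (snd p) * snd h) + ?D (fst p) (fst h) * \<eta> (snd p))) (at p)" for p
    unfolding \<phi>_def
  proof (rule has_derivative_mult)
    show "((\<lambda>x. \<psi> (fst x)) has_derivative (\<lambda>h. ?D (fst p) (fst h))) (at p)"
      by (rule has_derivative_compose[OF _ D\<psi>]) (auto intro: derivative_intros)
    show "((\<lambda>x. \<eta> (snd x)) has_derivative (\<lambda>h. \<eta>' (snd p) * snd h)) (at p)"
      by (rule has_derivative_compose[OF _ \<eta>(2)[unfolded has_field_derivative_def]])
         (auto intro: derivative_intros)
  qed
  from fun_cong[OF frechet_derivative_at[OF this], symmetric]
  have D\<phi>: "frechet_derivative \<phi> (at p) h = \<psi> (fst p) * (\<eta>' (snd p) * snd h) + ?D (fst p) (fst h) * \<eta> (snd p)"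
    for p h .
  have d3: "d3 \<phi> p = \<psi> (fst p) * \<eta>' (snd p)" for p
    by (simp add: d3_def D\<phi> D0)
  have grad: "grad' \<phi> p = \<eta> (snd p) *\<^sub>R (\<chi> i. ?D (fst p) (axis i 1))" for p
    by (simp add: grad'_def D\<phi> vec_eq_iff)
  have "norm (grad' \<phi> p) \<le> C" for p
    using mult_mono[OF \<eta>(3)[of "snd p"] C(2)[of "fst p"]] by (simp add: grad)
  then have bound: "\<bar>grad' \<phi> p \<bullet> v p\<bar> \<le> C * norm (v p)" for p
    by (meson Cauchy_Schwarz_ineq2 mult_right_mono norm_ge_zero order_trans)
  have eq: "(\<integral>p. d3 \<phi> p \<partial>\<mu>) = - (\<integral>p. grad' \<phi> p \<bullet> v p \<partial>\<mu>)"
    using m test by (auto simp: fluxes_def continuity_equation_def v_def eq_neg_iff_add_eq_0)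
  have "ennreal ((\<integral>p. grad' \<phi> p \<bullet> v p \<partial>\<mu>)\<^sup>2) \<le>
    ennreal (C\<^sup>2) * emeasure \<mu> (space \<mu>) * (\<integral>\<^sup>+p. ennreal ((norm (v p))\<^sup>2) \<partial>\<mu>)"
  proof (cases "C > 0 \<and> integrable \<mu> (\<lambda>p. grad' \<phi> p \<bullet> v p)")
    case True
    then have C0: "C > 0" and int: "integrable \<mu> (\<lambda>p. grad' \<phi> p \<bullet> v p)" by auto
    let ?f = "\<lambda>p. grad' \<phi> p \<bullet> v p"
    have [measurable]: "?f \<in> borel_measurable \<mu>" using int by simp
    have "ennreal ((integral\<^sup>L \<mu> ?f)\<^sup>2) = (ennreal \<bar>integral\<^sup>L \<mu> ?f\<bar>)\<^sup>2"
      by (simp add: ennreal_power)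
    also have "\<dots> \<le> (\<integral>\<^sup>+p. ennreal \<bar>?f p\<bar> * 1 \<partial>\<mu>)\<^sup>2"
      using integral_norm_bound_ennreal[OF int] by (intro power_mono) simp_all
    also have "\<dots> \<le> (\<integral>\<^sup>+p. (ennreal \<bar>?f p\<bar>)\<^sup>2 \<partial>\<mu>) * (\<integral>\<^sup>+p. 1\<^sup>2 \<partial>\<mu>)"
      by (rule Cauchy_Schwarz_nn_integral) measurable
    also have "\<dots> \<le>
        ennreal (C\<^sup>2) * (\<integral>\<^sup>+p. ennreal ((norm (v p))\<^sup>2) \<partial>\<mu>) * emeasure \<mu> (space \<mu>)"
    proof (rule mult_mono)
      have "(\<integral>\<^sup>+p. (ennreal \<bar>?f p\<bar>)\<^sup>2 \<partial>\<mu>) = (\<integral>\<^sup>+p. ennreal (C\<^sup>2) * ennreal ((?f p / C)\<^sup>2) \<partial>\<mu>)"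
        using C0 by (intro nn_integral_cong)
          (simp add: ennreal_power ennreal_mult[symmetric] power_divide)
      also have "\<dots> = ennreal (C\<^sup>2) * (\<integral>\<^sup>+p. ennreal ((?f p / C)\<^sup>2) \<partial>\<mu>)"
        by (rule nn_integral_cmult) measurable
      also have "\<dots> \<le> ennreal (C\<^sup>2) * (\<integral>\<^sup>+p. ennreal ((norm (v p))\<^sup>2) \<partial>\<mu>)"
      proof (intro mult_left_mono nn_integral_mono ennreal_leI)
        fix p
        have "\<bar>?f p / C\<bar> \<le> norm (v p)"
          using bound[of p] C0 by (simp add: field_simps)
        then show "(?f p / C)\<^sup>2 \<le> (norm (v p))\<^sup>2"
          by (metis abs_ge_zero power2_abs power_mono)
      qed simp
      finally show "(\<integral>\<^sup>+p. (ennreal \<bar>?f p\<bar>)\<^sup>2 \<partial>\<mu>) \<le>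
        ennreal (C\<^sup>2) * (\<integral>\<^sup>+p. ennreal ((norm (v p))\<^sup>2) \<partial>\<mu>)" .
    qed simp_all
    finally show ?thesis by (simp add: mult_ac)
  next
    case False
    then consider "C = 0" | "\<not> integrable \<mu> (\<lambda>p. grad' \<phi> p \<bullet> v p)" using C(1) by linarith
    then have "(\<integral>p. grad' \<phi> p \<bullet> v p \<partial>\<mu>) = 0"
      using bound by cases (simp_all add: not_integrable_integral_eq)
    then show ?thesis by simp
  qed
  then show ?thesis using eq by (simp add: d3 v_def)
qed

context sliced_measure
begin

lemma slice_integral_nn:
  fixes \<psi> :: "real^2 \<Rightarrow> real"
  assumes \<psi>: "\<psi> \<in> borel_measurable borel" "\<And>x. \<psi> x \<in> {0..1}" and t: "t \<in> I"
  shows "(\<integral>\<^sup>+x. ennreal (\<psi> x) \<partial>\<nu> t) = ennreal (\<integral>x. \<psi> x \<partial>\<nu> t)"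
proof (rule nn_integral_eq_integral)
  interpret finite_measure "\<nu> t" using slice_finite[OF t] .
  show "integrable (\<nu> t) \<psi>"
    using \<psi> by (intro integrable_const_bound[of _ 1] borel_slice[OF t]) auto
qed (use \<psi> in auto)

text \<open>
  A probability density \<open>\<rho>\<close> in \<open>x\<^sub>3\<close> averages the slice integrals, so its average is as close to \<open>y\<close>
  as the slice integrals on its support are.
\<close>

lemma average_near_slice:
  fixes \<psi> :: "real^2 \<Rightarrow> real"
  assumes \<psi>[measurable]: "\<psi> \<in> borel_measurable borel" and \<psi>01: "\<And>x. \<psi> x \<in> {0..1}"
    and \<rho>[measurable]: "\<rho> \<in> borel_measurable borel" and \<rho>0: "\<And>t. \<rho> t \<ge> 0"
    and supp: "\<And>t. t \<notin> D \<Longrightarrow> \<rho> t = 0" "D \<subseteq> I"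
    and one: "(\<integral>\<^sup>+t. ennreal (\<rho> t) \<partial>lborel) = 1"
    and near: "\<And>t. t \<in> D \<Longrightarrow> \<bar>(\<integral>x. \<psi> x \<partial>\<nu> t) - y\<bar> \<le> \<delta>"
  shows "integrable \<mu> (\<lambda>p. \<psi> (fst p) * \<rho> (snd p))"
    and "\<bar>(\<integral>p. \<psi> (fst p) * \<rho> (snd p) \<partial>\<mu>) - y\<bar> \<le> \<delta>"
proof -
  let ?F = "\<lambda>t. \<integral>x. \<psi> x \<partial>\<nu> t"
  let ?g = "\<lambda>p. \<psi> (fst p) * \<rho> (snd p)"
  have meas: "?g \<in> borel_measurable \<mu>" by measurable
  have g0: "?g p \<ge> 0" for p using \<psi>01[of "fst p"] \<rho>0 by auto
  have F0: "?F t \<ge> 0" for t using \<psi>01 by (intro Bochner_Integration.integral_nonneg) auto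
  have eq: "(\<integral>\<^sup>+p. ennreal (?g p) \<partial>\<mu>) = (\<integral>\<^sup>+t. ennreal (\<rho> t) * ennreal (?F t) \<partial>lborel)"
  proof -
    have "(\<integral>\<^sup>+p. ennreal (?g p) \<partial>\<mu>) = (\<integral>\<^sup>+p. ennreal (\<psi> (fst p)) * ennreal (\<rho> (snd p)) \<partial>\<mu>)"
      using \<psi>01 \<rho>0 by (intro nn_integral_cong ennreal_mult) auto
    also have "\<dots> = (\<integral>\<^sup>+t. ennreal (\<rho> t) * ((\<integral>\<^sup>+x. ennreal (\<psi> x) \<partial>\<nu> t) * indicator I t) \<partial>lborel)"
      by (rule nn_integral_slicing) measurable
    also have "\<dots> = (\<integral>\<^sup>+t. ennreal (\<rho> t) * ennreal (?F t) \<partial>lborel)"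
    proof (rule nn_integral_cong)
      fix t
      show "ennreal (\<rho> t) * ((\<integral>\<^sup>+x. ennreal (\<psi> x) \<partial>\<nu> t) * indicator I t) = ennreal (\<rho> t) * ennreal (?F t)"
      proof (cases "t \<in> D")
        case True
        then show ?thesis using slice_integral_nn[OF \<psi> \<psi>01, of t] supp(2) by auto
      qed (simp add: supp)
    qed
    finally show ?thesis .
  qed
  have "D \<noteq> {}" using one supp(1) by auto
  then have y\<delta>: "y + \<delta> \<ge> 0" using near F0 by (smt (verit) all_not_in_conv)
  have up: "(\<integral>\<^sup>+p. ennreal (?g p) \<partial>\<mu>) \<le> ennreal (y + \<delta>)"
  proof -
    have "(\<integral>\<^sup>+t. ennreal (\<rho> t) * ennreal (?F t) \<partial>lborel) \<le> (\<integral>\<^sup>+t. ennreal (\<rho> t) * ennreal (y + \<delta>) \<partial>lborel)"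
    proof (intro nn_integral_mono)
      fix t show "ennreal (\<rho> t) * ennreal (?F t) \<le> ennreal (\<rho> t) * ennreal (y + \<delta>)"
        using near[of t] supp(1)[of t]
        by (cases "t \<in> D") (auto intro!: mult_left_mono ennreal_leI simp: abs_le_iff)
    qed
    also have "\<dots> = ennreal (y + \<delta>)" by (subst nn_integral_multc) (auto simp: one)
    finally show ?thesis by (simp add: eq)
  qed
  show int: "integrable \<mu> ?g"
    using up meas g0 by (intro integrableI_nonneg) (auto simp: le_less_trans)
  have J: "(\<integral>\<^sup>+p. ennreal (?g p) \<partial>\<mu>) = ennreal (integral\<^sup>L \<mu> ?g)"
    using nn_integral_eq_integral[OF int] g0 by simp
  have low: "ennreal (y - \<delta>) \<le> (\<integral>\<^sup>+p. ennreal (?g p) \<partial>\<mu>)"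
  proof -
    have "ennreal (y - \<delta>) = (\<integral>\<^sup>+t. ennreal (\<rho> t) * ennreal (y - \<delta>) \<partial>lborel)"
      by (subst nn_integral_multc) (auto simp: one)
    also have "\<dots> \<le> (\<integral>\<^sup>+t. ennreal (\<rho> t) * ennreal (?F t) \<partial>lborel)"
    proof (intro nn_integral_mono)
      fix t show "ennreal (\<rho> t) * ennreal (y - \<delta>) \<le> ennreal (\<rho> t) * ennreal (?F t)"
        using near[of t] supp(1)[of t]
        by (cases "t \<in> D") (auto intro!: mult_left_mono ennreal_leI simp: abs_le_iff)
    qed
    finally show ?thesis by (simp add: eq)
  qed
  have J0: "integral\<^sup>L \<mu> ?g \<ge> 0" using g0 by (intro Bochner_Integration.integral_nonneg) auto
  have "integral\<^sup>L \<mu> ?g \<le> y + \<delta>" using up y\<delta> unfolding J by (simp add: ennreal_le_iff)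
  moreover have "y - \<delta> \<le> integral\<^sup>L \<mu> ?g"
    using low J0 unfolding J by (metis ennreal_le_iff)
  ultimately show "\<bar>integral\<^sup>L \<mu> ?g - y\<bar> \<le> \<delta>" by (simp add: abs_le_iff)
qed

end

lemma smooth_step_integral:
  fixes \<epsilon> :: real
  assumes "\<epsilon> > 0" "continuous_on UNIV f'" "\<And>t. (f has_real_derivative f' t) (at t)"
    "f c = 0" "f (c + \<epsilon>) = 1" "\<And>t. f' t \<ge> 0" "\<And>t. t \<notin> {c..c + \<epsilon>} \<Longrightarrow> f' t = 0"
  shows "(\<integral>\<^sup>+t. ennreal (f' t) \<partial>lborel) = 1"
proof -
  have "(\<integral>\<^sup>+t. ennreal (f' t) \<partial>lborel) = (\<integral>\<^sup>+t. ennreal (f' t) * indicator {c..c + \<epsilon>} t \<partial>lborel)"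
    using assms(7) by (intro nn_integral_cong) (simp add: indicator_def)
  also have "\<dots> = ennreal (f (c + \<epsilon>) - f c)"
    using assms by (intro nn_integral_FTC_Icc borel_measurable_continuous_onI) auto
  finally show ?thesis using assms by simp
qed

text \<open>
  The test function in \<open>x\<^sub>3\<close> is the difference of two smooth steps, just above \<open>a\<close> and just above
  \<open>b\<close>. Its derivative is the difference of two narrow probability densities, whose averages
  recover the slice integrals at \<open>a\<close> and \<open>b\<close> by continuity, while the test function itself
  stays between \<open>-1\<close> and \<open>1\<close>.
\<close>

lemma (in sliced_measure) slice_integral_variation_open:
  fixes \<psi> :: "real^2 \<Rightarrow> real"
  assumes cont: "continuous_on {-T..T} (\<lambda>t. \<integral>x. \<psi> x \<partial>\<nu> t)"
    and m: "m \<in> fluxes L T \<mu>"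
    and \<psi>: "\<And>n. Ck n \<psi>" "periodic L \<psi>" "\<And>x. \<psi> x \<in> {0..1}"
    and C: "C \<ge> 0" "\<And>x. norm (\<chi> i. frechet_derivative \<psi> (at x) (axis i 1) :: real^2) \<le> C"
    and M: "ennreal (C\<^sup>2) * emeasure \<mu> (space \<mu>) *
      (\<integral>\<^sup>+p. ennreal ((norm (vector_RN_deriv \<mu> m p))\<^sup>2) \<partial>\<mu>) \<le> ennreal (M\<^sup>2)" "M \<ge> 0"
    and ab: "-T < a" "a < b" "b < T"
  shows "\<bar>(\<integral>x. \<psi> x \<partial>\<nu> a) - (\<integral>x. \<psi> x \<partial>\<nu> b)\<bar> \<le> M"
proof (rule field_le_epsilon)
  let ?F = "\<lambda>t. \<integral>x. \<psi> x \<partial>\<nu> t"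
  fix e :: real assume e: "e > 0"
  have "\<exists>d>0. \<forall>t\<in>{-T..T}. \<bar>t - c\<bar> < d \<longrightarrow> \<bar>?F t - ?F c\<bar> < e / 2" if "c \<in> {-T..T}" for c
    using cont that e unfolding continuous_on_iff dist_real_def by (metis half_gt_zero)
  from this[of a] this[of b] ab obtain da db where
    d: "da > 0" "\<And>t. t \<in> {-T..T} \<Longrightarrow> \<bar>t - a\<bar> < da \<Longrightarrow> \<bar>?F t - ?F a\<bar> < e / 2"
       "db > 0" "\<And>t. t \<in> {-T..T} \<Longrightarrow> \<bar>t - b\<bar> < db \<Longrightarrow> \<bar>?F t - ?F b\<bar> < e / 2"
    by auto
  \<comment> \<open>The last entry keeps the upper step inside the open interval.\<close>
  define \<epsilon> where "\<epsilon> = min (min da db) (T - b) / 2"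
  have \<epsilon>: "\<epsilon> > 0" "\<epsilon> < da" "\<epsilon> < db" "\<epsilon> < T - b"
    using d(1,3) ab by (auto simp: \<epsilon>_def)
  obtain f f' where f: "\<And>n. Ck n f" "\<And>t. (f has_real_derivative f' t) (at t)"
    "continuous_on UNIV f'"
    "\<And>t. f t \<in> {0..1}" "\<And>t. t \<le> a \<Longrightarrow> f t = 0" "\<And>t. t \<ge> a + \<epsilon> \<Longrightarrow> f t = 1"
    "\<And>t. f' t \<ge> 0" "\<And>t. t \<notin> {a..a + \<epsilon>} \<Longrightarrow> f' t = 0"
    using smooth_step[OF \<epsilon>(1), of a] by metis
  obtain g g' where g: "\<And>n. Ck n g" "\<And>t. (g has_real_derivative g' t) (at t)"
    "continuous_on UNIV g'"
    "\<And>t. g t \<in> {0..1}" "\<And>t. t \<le> b \<Longrightarrow> g t = 0" "\<And>t. t \<ge> b + \<epsilon> \<Longrightarrow> g t = 1"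
    "\<And>t. g' t \<ge> 0" "\<And>t. t \<notin> {b..b + \<epsilon>} \<Longrightarrow> g' t = 0"
    using smooth_step[OF \<epsilon>(1), of b] by metis
  have \<psi>m: "\<psi> \<in> borel_measurable borel"
    using \<psi>(1)[of 0] by (simp add: borel_measurable_continuous_onI)
  have fa: "integrable \<mu> (\<lambda>p. \<psi> (fst p) * f' (snd p))"
    "\<bar>(\<integral>p. \<psi> (fst p) * f' (snd p) \<partial>\<mu>) - ?F a\<bar> \<le> e / 2"
  proof -
    note one = smooth_step_integral[OF \<epsilon>(1) f(3) f(2) f(5)[OF order_refl] f(6)[OF order_refl] f(7,8)]
    have near: "\<bar>?F t - ?F a\<bar> \<le> e / 2" if "t \<in> {a..a + \<epsilon>}" for t
      using d(2)[of t] that ab \<epsilon> by (simp add: less_imp_le)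
    have sub: "{a..a + \<epsilon>} \<subseteq> I" using ab \<epsilon> by auto
    show "integrable \<mu> (\<lambda>p. \<psi> (fst p) * f' (snd p))"
      "\<bar>(\<integral>p. \<psi> (fst p) * f' (snd p) \<partial>\<mu>) - ?F a\<bar> \<le> e / 2"
      using average_near_slice[OF \<psi>m \<psi>(3) borel_measurable_continuous_onI[OF f(3)] f(7,8) sub one near]
      by simp_all
  qed
  have gb: "integrable \<mu> (\<lambda>p. \<psi> (fst p) * g' (snd p))"
    "\<bar>(\<integral>p. \<psi> (fst p) * g' (snd p) \<partial>\<mu>) - ?F b\<bar> \<le> e / 2"
  proof -
    note one = smooth_step_integral[OF \<epsilon>(1) g(3) g(2) g(5)[OF order_refl] g(6)[OF order_refl] g(7,8)]
    have near: "\<bar>?F t - ?F b\<bar> \<le> e / 2" if "t \<in> {b..b + \<epsilon>}" for t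
      using d(4)[of t] that ab \<epsilon> by (simp add: less_imp_le)
    have sub: "{b..b + \<epsilon>} \<subseteq> I" using ab \<epsilon> by auto
    show "integrable \<mu> (\<lambda>p. \<psi> (fst p) * g' (snd p))"
      "\<bar>(\<integral>p. \<psi> (fst p) * g' (snd p) \<partial>\<mu>) - ?F b\<bar> \<le> e / 2"
      using average_near_slice[OF \<psi>m \<psi>(3) borel_measurable_continuous_onI[OF g(3)] g(7,8) sub one near]
      by simp_all
  qed
  have "ennreal ((\<integral>p. \<psi> (fst p) * (f' (snd p) - g' (snd p)) \<partial>\<mu>)\<^sup>2) \<le> ennreal (M\<^sup>2)"
  proof (rule order_trans[OF flux_estimate[OF fin m \<psi>(1,2) C, where \<eta> = "\<lambda>t. f t - g t" and
        \<eta>' = "\<lambda>t. f' t - g' t" and s = "max \<bar>a\<bar> \<bar>b + \<epsilon>\<bar>"] M(1)])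
    show "Ck n (\<lambda>t. f t - g t)" for n by (rule Ck_minus[OF f(1) g(1)])
    show "((\<lambda>t. f t - g t) has_real_derivative f' t - g' t) (at t)" for t
      by (rule DERIV_diff[OF f(2) g(2)])
    show "\<bar>f t - g t\<bar> \<le> 1" for t using f(4)[of t] g(4)[of t] by auto
    show "max \<bar>a\<bar> \<bar>b + \<epsilon>\<bar> < T" using ab \<epsilon> by auto
    fix t assume "max \<bar>a\<bar> \<bar>b + \<epsilon>\<bar> \<le> \<bar>t\<bar>"
    then have "t \<le> a \<or> t \<ge> b + \<epsilon>" by linarith
    then show "f t - g t = 0" using f(5,6)[of t] g(5,6)[of t] ab \<epsilon> by auto
  qed
  then have "\<bar>\<integral>p. \<psi> (fst p) * (f' (snd p) - g' (snd p)) \<partial>\<mu>\<bar> \<le> M"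
    using M(2) by (simp add: ennreal_le_iff abs_le_square_iff[symmetric])
  moreover have "(\<integral>p. \<psi> (fst p) * (f' (snd p) - g' (snd p)) \<partial>\<mu>) =
      (\<integral>p. \<psi> (fst p) * f' (snd p) \<partial>\<mu>) - (\<integral>p. \<psi> (fst p) * g' (snd p) \<partial>\<mu>)"
    using fa(1) gb(1) by (simp add: right_diff_distrib)
  ultimately show "\<bar>?F a - ?F b\<bar> \<le> M + e" using fa(2) gb(2) by linarith
qed

lemma (in sliced_measure) slice_integral_variation:
  fixes \<psi> :: "real^2 \<Rightarrow> real"
  assumes cont: "continuous_on {-T..T} (\<lambda>t. \<integral>x. \<psi> x \<partial>\<nu> t)"
    and m: "m \<in> fluxes L T \<mu>"
    and \<psi>: "\<And>n. Ck n \<psi>" "periodic L \<psi>" "\<And>x. \<psi> x \<in> {0..1}"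
    and C: "C \<ge> 0" "\<And>x. norm (\<chi> i. frechet_derivative \<psi> (at x) (axis i 1) :: real^2) \<le> C"
    and M: "ennreal (C\<^sup>2) * emeasure \<mu> (space \<mu>) *
      (\<integral>\<^sup>+p. ennreal ((norm (vector_RN_deriv \<mu> m p))\<^sup>2) \<partial>\<mu>) \<le> ennreal (M\<^sup>2)" "M \<ge> 0"
    and t: "t \<in> I"
  shows "\<bar>(\<integral>x. \<psi> x \<partial>\<nu> t) - (\<integral>x. \<psi> x \<partial>\<nu> T)\<bar> \<le> M"
proof -
  let ?F = "\<lambda>t. \<integral>x. \<psi> x \<partial>\<nu> t"
  have cl: "closure {t<..<T} = {t..T}" using t by (simp add: closure_greaterThanLessThan)
  have "continuous_on (closure {t<..<T}) (\<lambda>s. \<bar>?F t - ?F s\<bar>)"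
    unfolding cl by (intro continuous_intros continuous_on_subset[OF cont]) (use t in auto)
  then show ?thesis
  proof (rule continuous_le_on_closure)
    show "T \<in> closure {t<..<T}" using t cl by simp
    show "\<bar>?F t - ?F s\<bar> \<le> M" if "s \<in> {t<..<T}" for s
      using that t by (intro slice_integral_variation_open[OF cont m \<psi> C M]) auto
  qed
qed

section \<open>Periodic functions concentrating near finitely many points\<close>

text \<open>
  A smooth \<open>L\<close>-periodic peak of height \<open>1\<close> and width \<open>r\<close>. Replacing \<open>sin y\<close> by \<open>y\<close> gives the
  Lorentz profile \<open>1 / (1 + (z/r)\<^sup>2)\<close>; unlike a bump of compact support it has a bounded
  logarithmic derivative.
\<close>

definition bump :: "real \<Rightarrow> real \<Rightarrow> real \<Rightarrow> real" where
  "bump L r z = inverse (1 + (L / (pi * r) * sin (pi * z / L))\<^sup>2)"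

definition bump' :: "real \<Rightarrow> real \<Rightarrow> real \<Rightarrow> real" where
  "bump' L r z = - (bump L r z)\<^sup>2 *
     (2 * (L / (pi * r) * sin (pi * z / L)) * (cos (pi * z / L) / r))"

lemma bump_pos: "bump L r z > 0" and bump_le_1: "bump L r z \<le> 1" and bump_0: "bump L r 0 = 1"
proof -
  define q where "q = 1 + (L / (pi * r) * sin (pi * z / L))\<^sup>2"
  have "q \<ge> 1" by (simp add: q_def)
  then have "inverse q > 0" "inverse q \<le> 1" by (simp_all add: inverse_le_1_iff)
  then show "bump L r z > 0" "bump L r z \<le> 1" unfolding bump_def q_def .
qed (simp add: bump_def)

lemma bump_periodic:
  assumes "L > 0"
  shows "bump L r (z + L) = bump L r z"
proof -
  have "pi * (z + L) / L = pi * z / L + pi" using assms by (simp add: field_simps)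
  then show ?thesis by (simp add: bump_def)
qed

lemma Ck_bump: "Ck n (bump L r)"
proof -
  have l: "bounded_linear (\<lambda>z. pi * z / L)"
    by (intro bounded_linear_divide[THEN bounded_linear_compose] bounded_linear_mult_right)
  have "Ck n (\<lambda>z. sin (pi * z / L + 0))"
    using Ck_affine[OF l conjunct1[OF Ck_sin_cos]] .
  then have "Ck n (\<lambda>z. sin (pi * z / L))" by simp
  then show ?thesis
    unfolding bump_def[abs_def] power2_eq_square
    by (intro Ck_inverse Ck_add Ck_const Ck_mult) (simp add: add_nonneg_eq_0_iff)
qed

lemma bump_has_derivative:
  assumes "L > 0" "r > 0"
  shows "(bump L r has_real_derivative bump' L r z) (at z)"
proof -
  define u where "u z = L / (pi * r) * sin (pi * z / L)" for z
  have "(u has_real_derivative cos (pi * z / L) / r) (at z)"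
    unfolding u_def[abs_def] using assms by (auto intro!: derivative_eq_intros)
  then have "((\<lambda>z. inverse (1 + (u z)\<^sup>2)) has_real_derivative
      - (inverse (1 + (u z)\<^sup>2))\<^sup>2 * (2 * u z * (cos (pi * z / L) / r))) (at z)"
    by (auto intro!: derivative_eq_intros simp: power2_eq_square add_nonneg_eq_0_iff)
  then show ?thesis by (simp add: bump_def[abs_def] bump'_def u_def[abs_def])
qed

text \<open>The logarithmic derivative is at most \<open>1/r\<close> because \<open>2 * \<bar>u\<bar> \<le> 1 + u\<^sup>2\<close>.\<close>

lemma bump_log_derivative:
  assumes "r > 0"
  shows "\<bar>bump' L r z\<bar> \<le> bump L r z / r"
proof -
  define u where "u = L / (pi * r) * sin (pi * z / L)"
  define q where "q = 1 + u\<^sup>2"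
  have "0 \<le> (\<bar>u\<bar> - 1)\<^sup>2" by simp
  then have "2 * \<bar>u\<bar> \<le> q" by (simp add: q_def power2_diff)
  then have q: "q > 0" "2 * \<bar>u\<bar> \<le> q" "bump L r z = inverse q"
    by (simp_all only: bump_def u_def[symmetric] q_def) (simp add: add_pos_nonneg)
  have "\<bar>bump' L r z\<bar> = (inverse q)\<^sup>2 * (2 * \<bar>u\<bar> * (\<bar>cos (pi * z / L)\<bar> / r))"
    unfolding bump'_def u_def[symmetric] q(3) using assms q(1) by (simp add: abs_mult)
  also have "\<dots> \<le> (inverse q)\<^sup>2 * (q * (1 / r))"
    using assms q by (intro mult_left_mono mult_mono divide_right_mono) auto
  also have "\<dots> = inverse q / r" using q(1) by (simp add: power2_eq_square field_simps)
  finally show ?thesis by (simp add: q)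
qed

lemma sin_ge_quarter:
  assumes "0 \<le> x" "x \<le> pi / 2"
  shows "sin x \<ge> x / 4"
proof (cases "x \<le> pi / 3")
  case True
  have "sin 0 - 0 / 4 \<le> sin x - x / 4"
  proof (rule DERIV_nonneg_imp_nondecreasing[OF assms(1)])
    fix y assume y: "0 \<le> y" "y \<le> x"
    have "cos y \<ge> cos (pi / 3)" using y True by (intro cos_monotone_0_pi_le) auto
    then show "\<exists>d. ((\<lambda>x. sin x - x / 4) has_real_derivative d) (at y) \<and> 0 \<le> d"
      by (intro exI[of _ "cos y - 1 / 4"]) (auto intro!: derivative_eq_intros simp: cos_60)
  qed
  then show ?thesis by simp
next
  case False
  have "sin x \<ge> sin (pi / 3)" using assms False by (intro sin_monotone_2pi_le) auto
  then have "sin x \<ge> sqrt 3 / 2" by (simp add: sin_60)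
  moreover have "sqrt 3 \<ge> 1" by simp
  ultimately show ?thesis using assms pi_less_4 by linarith
qed

text \<open>The width is \<open>4 * r\<close> instead of \<open>r\<close> to absorb the constant in \<open>sin x \<ge> x / 4\<close>.\<close>

definition lorentz :: "real \<Rightarrow> real \<Rightarrow> real" where
  "lorentz r z = inverse (1 + (z / (4 * r))\<^sup>2)"

lemma lorentz_pos: "lorentz r z > 0"
  by (simp add: lorentz_def add_pos_nonneg)

lemma bump_le_lorentz_near:
  assumes "L > 0" "r > 0" "\<bar>z\<bar> \<le> L / 2"
  shows "bump L r z \<le> lorentz r z"
proof -
  have s: "\<bar>sin (pi * z / L)\<bar> \<ge> \<bar>pi * z / L\<bar> / 4"
  proof -
    have "sin (\<bar>pi * z / L\<bar>) \<ge> \<bar>pi * z / L\<bar> / 4"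
      using assms by (intro sin_ge_quarter) (auto simp: abs_mult field_simps)
    moreover have "sin \<bar>y\<bar> \<le> \<bar>sin y\<bar>" for y :: real by (simp add: abs_if)
    ultimately show ?thesis using order_trans by blast
  qed
  have "\<bar>z / (4 * r)\<bar> = L / (pi * r) * (\<bar>pi * z / L\<bar> / 4)"
    using assms by (simp add: abs_mult field_simps)
  also have "\<dots> \<le> L / (pi * r) * \<bar>sin (pi * z / L)\<bar>"
    using assms by (intro mult_left_mono s) simp
  also have "\<dots> = \<bar>L / (pi * r) * sin (pi * z / L)\<bar>" using assms by (simp add: abs_mult)
  finally have "(z / (4 * r))\<^sup>2 \<le> (L / (pi * r) * sin (pi * z / L))\<^sup>2"
    by (simp only: abs_le_square_iff)
  then show ?thesis
    unfolding bump_def lorentz_def by (intro le_imp_inverse_le) (auto intro: add_pos_nonneg)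
qed

text \<open>
  The difference of two points of the cell ranges over an interval of length \<open>2 * L\<close>, in which
  three peaks of the periodic function lie.
\<close>

lemma bump_le_lorentz:
  assumes "L > 0" "r > 0" "\<bar>z\<bar> \<le> L"
  shows "bump L r z \<le> lorentz r z + lorentz r (z - L) + lorentz r (z + L)"
proof -
  consider "\<bar>z\<bar> \<le> L / 2" | "z > L / 2" | "z < - L / 2" by linarith
  then show ?thesis
  proof cases
    case 1
    then show ?thesis
      using bump_le_lorentz_near[of L r z] assms lorentz_pos[of r "z - L"] lorentz_pos[of r "z + L"] by auto
  next
    case 2
    then have "bump L r (z - L) \<le> lorentz r (z - L)"
      using assms by (intro bump_le_lorentz_near) auto
    moreover have "bump L r (z - L) = bump L r z" using bump_periodic[OF assms(1), of r "z - L"] by simp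
    ultimately show ?thesis using lorentz_pos[of r z] lorentz_pos[of r "z + L"] by auto
  next
    case 3
    then have "bump L r (z + L) \<le> lorentz r (z + L)"
      using assms by (intro bump_le_lorentz_near) auto
    then show ?thesis
      using lorentz_pos[of r z] lorentz_pos[of r "z - L"] bump_periodic[OF assms(1), of r z] by auto
  qed
qed

lemma lorentz_integral:
  assumes "r > 0" "a \<le> b"
  shows "(\<integral>\<^sup>+z. ennreal (lorentz r (z - d)) * indicator {a..b} z \<partial>lborel) \<le> ennreal (16 * r)"
proof -
  define F where "F z = 4 * r * arctan ((z - d) / (4 * r))" for z
  have D: "(F has_real_derivative lorentz r (z - d)) (at z)" for z
    unfolding F_def[abs_def] lorentz_def using assms
    by (auto intro!: derivative_eq_intros)
  have meas: "(\<lambda>z. lorentz r (z - d)) \<in> borel_measurable borel"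
    unfolding lorentz_def by measurable
  have "(\<integral>\<^sup>+z. ennreal (lorentz r (z - d)) * indicator {a..b} z \<partial>lborel) = ennreal (F b - F a)"
    using assms by (intro nn_integral_FTC_Icc meas D less_imp_le[OF lorentz_pos])
  also have "F b - F a = 4 * r * (arctan ((b - d) / (4 * r)) - arctan ((a - d) / (4 * r)))"
    by (simp add: F_def right_diff_distrib)
  also have "\<dots> \<le> 4 * r * 4"
    using arctan_ubound[of "(b - d) / (4 * r)"] arctan_lbound[of "(a - d) / (4 * r)"] pi_less_4 assms
    by (intro mult_left_mono) auto
  finally show ?thesis using assms by (simp add: ennreal_leI)
qed

lemma borel_bump [measurable]: "bump L r \<in> borel_measurable borel"
  unfolding bump_def[abs_def] by measurable

lemma bump_integral:
  assumes "L > 0" "r > 0" "- L / 2 \<le> c" "c \<le> L / 2"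
  shows "(\<integral>\<^sup>+z. ennreal (bump L r (z - c)) * indicator {-L/2..<L/2} z \<partial>lborel) \<le> ennreal (48 * r)"
proof -
  let ?J = "{-L/2..L/2}"
  let ?h = "\<lambda>d z. ennreal (lorentz r (z - d)) * indicator ?J z"
  have hm: "?h d \<in> borel_measurable lborel" for d
    unfolding lorentz_def by measurable
  have "(\<integral>\<^sup>+z. ennreal (bump L r (z - c)) * indicator {-L/2..<L/2} z \<partial>lborel) \<le>
      (\<integral>\<^sup>+z. ?h c z + ?h (c + L) z + ?h (c - L) z \<partial>lborel)"
  proof (intro nn_integral_mono)
    fix z
    have "bump L r (z - c) \<le> lorentz r (z - c) + lorentz r (z - (c + L)) + lorentz r (z - (c - L))"
      if "z \<in> ?J"
      using bump_le_lorentz[of L r "z - c"] that assms by (auto simp: algebra_simps abs_le_iff)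
    then have "ennreal (bump L r (z - c)) \<le>
        ennreal (lorentz r (z - c)) + ennreal (lorentz r (z - (c + L))) + ennreal (lorentz r (z - (c - L)))"
      if "z \<in> ?J" using that lorentz_pos[of r, THEN less_imp_le]
      by (simp add: ennreal_plus[symmetric] ennreal_leI del: ennreal_plus)
    then show "ennreal (bump L r (z - c)) * indicator {-L/2..<L/2} z \<le> ?h c z + ?h (c + L) z + ?h (c - L) z"
      by (auto simp: indicator_def)
  qed
  also have "\<dots> = (\<integral>\<^sup>+z. ?h c z \<partial>lborel) + (\<integral>\<^sup>+z. ?h (c + L) z \<partial>lborel) + (\<integral>\<^sup>+z. ?h (c - L) z \<partial>lborel)"
    by (simp only: nn_integral_add borel_measurable_add hm)
  also have "\<dots> \<le> ennreal (16 * r) + ennreal (16 * r) + ennreal (16 * r)"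
    using assms by (intro add_mono lorentz_integral) auto
  also have "\<dots> = ennreal (48 * r)"
    using assms by (simp add: ennreal_plus[symmetric] del: ennreal_plus)
  finally show ?thesis .
qed

definition bump2 :: "real \<Rightarrow> real \<Rightarrow> real^2 \<Rightarrow> real^2 \<Rightarrow> real" where
  "bump2 L r X x = bump L r (x $ 1 - X $ 1) * bump L r (x $ 2 - X $ 2)"

lemma nn_integral_cell_prod:
  fixes f g :: "real \<Rightarrow> ennreal"
  assumes [measurable]: "f \<in> borel_measurable borel" "g \<in> borel_measurable borel"
  shows "(\<integral>\<^sup>+x. f (x $ 1) * g (x $ 2) * indicator (cell L) x \<partial>lborel) =
    (\<integral>\<^sup>+z. f z * indicator {-L/2..<L/2} z \<partial>lborel) * (\<integral>\<^sup>+z. g z * indicator {-L/2..<L/2} z \<partial>lborel)"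
proof -
  let ?h = "\<lambda>(b::real^2) z. (if b = axis 1 1 then f z else g z) * indicator {-L/2..<L/2} z"
  have B: "(Basis :: (real^2) set) = {axis 1 1, axis 2 1}" by (auto simp: Basis_vec_def UNIV_2)
  have two: "(\<Prod>b\<in>Basis. k b) = k (axis 1 1) * k (axis 2 1)" for k :: "real^2 \<Rightarrow> ennreal"
    unfolding B by (simp add: axis_eq_axis)
  have "(\<integral>\<^sup>+x. f (x $ 1) * g (x $ 2) * indicator (cell L) x \<partial>lborel) =
      (\<integral>\<^sup>+x. (\<Prod>b\<in>Basis. ?h b (x \<bullet> b)) \<partial>lborel)"
  proof (rule nn_integral_cong)
    fix x :: "real^2"
    have "indicator (cell L) x = (indicator {-L/2..<L/2} (x $ 1) * indicator {-L/2..<L/2} (x $ 2) :: ennreal)"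
      by (auto simp: cell_def indicator_def forall_2)
    then show "f (x $ 1) * g (x $ 2) * indicator (cell L) x = (\<Prod>b\<in>Basis. ?h b (x \<bullet> b))"
      by (simp add: two axis_eq_axis cart_eq_inner_axis[symmetric] mult_ac)
  qed
  also have "\<dots> = (\<Prod>b\<in>Basis. \<integral>\<^sup>+z. ?h b z \<partial>lborel)"
  proof (rule nn_integral_lborel_prod)
    show "?h b \<in> borel_measurable borel" for b
    proof (intro borel_measurable_times_ennreal borel_measurable_indicator)
      show "(\<lambda>z. if b = axis 1 1 then f z else g z) \<in> borel_measurable borel" by measurable
    qed simp
  qed simp
  finally show ?thesis by (simp add: two axis_eq_axis)
qed

lemma emeasure_cell:
  assumes "L > 0"
  shows "emeasure lborel (cell L) = ennreal (L\<^sup>2)"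
proof -
  have "emeasure lborel (cell L) = (\<integral>\<^sup>+x. 1 * 1 * indicator (cell L) x \<partial>lborel)" by simp
  also have "\<dots> = ennreal L * ennreal L"
    using assms by (subst nn_integral_cell_prod) simp_all
  finally show ?thesis using assms by (simp add: ennreal_mult[symmetric] power2_eq_square)
qed

lemma bump2_integral:
  assumes "L > 0" "r > 0" "X \<in> cell L"
  shows "(\<integral>\<^sup>+x. ennreal (bump2 L r X x) * indicator (cell L) x \<partial>lborel) \<le> ennreal ((48 * r)\<^sup>2)"
proof -
  have "(\<integral>\<^sup>+x. ennreal (bump2 L r X x) * indicator (cell L) x \<partial>lborel) =
      (\<integral>\<^sup>+x. ennreal (bump L r (x $ 1 - X $ 1)) * ennreal (bump L r (x $ 2 - X $ 2)) *
        indicator (cell L) x \<partial>lborel)"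
    using bump_pos[THEN less_imp_le] by (simp add: bump2_def ennreal_mult)
  also have "\<dots> =
      (\<integral>\<^sup>+z. ennreal (bump L r (z - X $ 1)) * indicator {-L/2..<L/2} z \<partial>lborel) *
      (\<integral>\<^sup>+z. ennreal (bump L r (z - X $ 2)) * indicator {-L/2..<L/2} z \<partial>lborel)"
    by (rule nn_integral_cell_prod) measurable
  also have "\<dots> \<le> ennreal (48 * r) * ennreal (48 * r)"
    using assms by (intro mult_mono bump_integral) (auto simp: cell_def less_imp_le)
  also have "\<dots> = ennreal ((48 * r)\<^sup>2)"
    using assms by (simp add: ennreal_mult[symmetric] power2_eq_square)
  finally show ?thesis .
qed

lemma bump2_has_derivative:
  assumes "L > 0" "r > 0"
  shows "(bump2 L r X has_derivative (\<lambda>h. bump L r (x $ 1 - X $ 1) * (bump' L r (x $ 2 - X $ 2) * h $ 2) +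
      bump' L r (x $ 1 - X $ 1) * h $ 1 * bump L r (x $ 2 - X $ 2))) (at x)"
proof -
  have "((\<lambda>x. bump L r (x $ i - X $ i)) has_derivative (\<lambda>h. bump' L r (x $ i - X $ i) * h $ i)) (at x)" for i
  proof (rule has_derivative_compose[OF _ bump_has_derivative[OF assms, unfolded has_field_derivative_def]])
    show "((\<lambda>x. x $ i - X $ i) has_derivative (\<lambda>h. h $ i)) (at x)"
      using has_derivative_diff[OF bounded_linear_imp_has_derivative[OF bounded_linear_vec_nth[of i]] has_derivative_const]
      by simp
  qed
  from has_derivative_mult[OF this[of 1] this[of 2]] show ?thesis
    by (simp add: bump2_def[abs_def])
qed

lemma bump2_axis_derivative:
  assumes "L > 0" "r > 0"
  shows "\<bar>frechet_derivative (bump2 L r X) (at x) (axis i 1)\<bar> \<le> bump2 L r X x / r"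
proof -
  note b = bump_log_derivative[OF assms(2), of L] bump_pos[of L r]
  have *: "frechet_derivative (bump2 L r X) (at x) = (\<lambda>h. bump L r (x $ 1 - X $ 1) * (bump' L r (x $ 2 - X $ 2) * h $ 2) +
      bump' L r (x $ 1 - X $ 1) * h $ 1 * bump L r (x $ 2 - X $ 2))"
    using frechet_derivative_at[OF bump2_has_derivative[OF assms]] by simp
  have m: "\<bar>bump L r y * bump' L r z\<bar> \<le> bump L r y * bump L r z / r" for y z
    using mult_left_mono[OF b(1)[of z] less_imp_le[OF b(2)[of y]]] b(2)[of y] by (simp add: abs_mult)
  consider "i = 1" | "i = 2" using exhaust_2 by auto
  then show ?thesis
  proof cases
    case 1
    then show ?thesis
      using m[of "x $ 2 - X $ 2" "x $ 1 - X $ 1"] by (simp add: * bump2_def axis_def mult_ac)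
  next
    case 2
    then show ?thesis
      using m[of "x $ 1 - X $ 1" "x $ 2 - X $ 2"] by (simp add: * bump2_def axis_def mult_ac)
  qed
qed

lemma Ck_bump2: "Ck n (bump2 L r X)"
proof -
  have "Ck n (\<lambda>x::real^2. bump L r (x $ i + - X $ i))" for i
    by (rule Ck_affine[OF bounded_linear_vec_nth Ck_bump])
  then show ?thesis unfolding bump2_def[abs_def] by (intro Ck_mult) simp_all
qed

lemma bump2_periodic:
  assumes "L > 0"
  shows "bump2 L r X (x + L *\<^sub>R axis i 1) = bump2 L r X x"
proof -
  have "bump L r (y + L - c) = bump L r (y - c)" for y c
    using bump_periodic[OF assms, of r "y - c"] by (simp add: algebra_simps)
  then show ?thesis by (simp add: bump2_def axis_def)
qed

text \<open>
  Composing the sum \<open>s\<close> of bumps with \<open>s / (1 + s)\<close> truncates it, and the bound on the logarithmic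
  derivative of the bumps survives the summation: the gradient stays of order \<open>1/r\<close> however
  many of the points cluster.
\<close>

lemma concentrating_function:
  assumes L: "L > 0" and r: "r > 0" and B: "finite B" "B \<subseteq> cell L"
  obtains \<psi> :: "real^2 \<Rightarrow> real" where "\<And>n. Ck n \<psi>" "periodic L \<psi>" "\<And>x. \<psi> x \<in> {0..1}"
    "\<And>x. norm (\<chi> i. frechet_derivative \<psi> (at x) (axis i 1) :: real^2) \<le> 2 / r"
    "\<And>X. X \<in> B \<Longrightarrow> \<psi> X \<ge> 1 / 2"
    "(\<integral>\<^sup>+x. ennreal (\<psi> x) * indicator (cell L) x \<partial>lborel) \<le> ennreal (real (card B) * (48 * r)\<^sup>2)"
proof -
  define S where "S x = (\<Sum>X\<in>B. bump2 L r X x)" for x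
  define \<psi> where "\<psi> x = 1 - inverse (1 + S x)" for x
  have b0: "bump2 L r X x > 0" for X x using bump_pos by (simp add: bump2_def)
  have S0: "S x \<ge> 0" for x unfolding S_def using b0 by (intro sum_nonneg) (simp add: less_imp_le)
  have S1: "1 + S x > 0" "1 + S x \<noteq> 0" for x using S0[of x] by auto
  have CkS: "Ck n S" for n unfolding S_def[abs_def] by (intro Ck_sum Ck_bump2)
  have \<psi>S: "\<psi> x = S x / (1 + S x)" for x using S1[of x] by (simp add: \<psi>_def field_simps)
  have le: "\<psi> x \<le> S x" for x
    using S0[of x] S1[of x] by (simp add: \<psi>S field_simps)
  show thesis
  proof (rule that[of \<psi>])
    show "Ck n \<psi>" for n
      unfolding \<psi>_def[abs_def] by (intro Ck_minus Ck_inverse Ck_add Ck_const CkS S1)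
    show "periodic L \<psi>"
      by (simp add: periodic_def \<psi>_def S_def bump2_periodic[OF L])
    show "\<psi> x \<in> {0..1}" for x using S0[of x] S1[of x] by (simp add: \<psi>S)
    show "\<psi> X \<ge> 1 / 2" if "X \<in> B" for X
    proof -
      have "bump2 L r X X \<le> S X"
        unfolding S_def using B(1) that b0 by (intro member_le_sum) (auto simp: less_imp_le)
      then have "S X \<ge> 1" by (simp add: bump2_def bump_0)
      then show ?thesis by (simp add: \<psi>S field_simps)
    qed
    fix x
    let ?D = "\<lambda>f i. frechet_derivative f (at x) (axis i 1 :: real^2)"
    have DS: "?D S i = (\<Sum>X\<in>B. ?D (bump2 L r X) i)" for i
    proof -
      have "(S has_derivative (\<lambda>h. \<Sum>X\<in>B. frechet_derivative (bump2 L r X) (at x) h)) (at x)"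
        unfolding S_def[abs_def] by (intro has_derivative_sum Ck_SucD(1)[OF Ck_bump2])
      from frechet_derivative_at[OF this] show ?thesis by (metis (no_types))
    qed
    have DS_le: "\<bar>?D S i\<bar> \<le> S x / r" for i
    proof -
      have "\<bar>?D S i\<bar> \<le> (\<Sum>X\<in>B. bump2 L r X x / r)"
        unfolding DS by (intro order_trans[OF sum_abs] sum_mono bump2_axis_derivative[OF L r])
      then show ?thesis by (simp add: S_def sum_divide_distrib)
    qed
    have D\<psi>: "?D \<psi> i = ?D S i * (inverse (1 + S x))\<^sup>2" for i
    proof -
      have "((\<lambda>x. 1 + S x) has_derivative (\<lambda>h. 0 + frechet_derivative S (at x) h)) (at x)"
        by (intro has_derivative_add has_derivative_const Ck_SucD(1)[OF CkS])
      from has_derivative_diff[OF has_derivative_const Deriv.has_derivative_inverse[OF S1(2) this], of 1]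
      have "(\<psi> has_derivative (\<lambda>h. 0 - - (inverse (1 + S x) * (0 + frechet_derivative S (at x) h) * inverse (1 + S x)))) (at x)"
        unfolding \<psi>_def[abs_def] .
      from fun_cong[OF frechet_derivative_at[OF this], symmetric] show ?thesis
        by (simp add: power2_eq_square)
    qed
    have "\<bar>?D \<psi> i\<bar> \<le> S x / r * (inverse (1 + S x))\<^sup>2" for i
      using mult_right_mono[OF DS_le[of i], of "(inverse (1 + S x))\<^sup>2"] by (simp add: D\<psi> abs_mult)
    also have "S x / r * (inverse (1 + S x))\<^sup>2 \<le> 1 / r"
    proof -
      have "S x * 1 \<le> (1 + S x) * (1 + S x)" using S0[of x] by (intro mult_mono) auto
      then have "S x * (inverse (1 + S x))\<^sup>2 \<le> (1 + S x) * (1 + S x) * (inverse (1 + S x))\<^sup>2"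
        by (intro mult_right_mono) auto
      also have "\<dots> = ((1 + S x) * inverse (1 + S x))\<^sup>2" by (simp only: power2_eq_square mult_ac)
      also have "\<dots> = 1" unfolding right_inverse[OF S1(2)] by simp
      finally show ?thesis using r by (simp add: divide_right_mono)
    qed
    finally have D1: "\<bar>?D \<psi> i\<bar> \<le> 1 / r" for i .
    have "norm (\<chi> i. ?D \<psi> i :: real^2) \<le> (\<Sum>i\<in>UNIV. \<bar>?D \<psi> i\<bar>)"
      using norm_le_l1_cart[of "\<chi> i. ?D \<psi> i"] by simp
    also have "\<dots> \<le> 2 / r" using D1[of 1] D1[of 2] by (simp add: UNIV_2)
    finally show "norm (\<chi> i. ?D \<psi> i :: real^2) \<le> 2 / r" .
  next
    have meas: "(\<lambda>x. ennreal (bump2 L r X x) * indicator (cell L) x) \<in> borel_measurable lborel" for X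
      unfolding bump2_def cart_eq_inner_axis by measurable
    have "(\<integral>\<^sup>+x. ennreal (\<psi> x) * indicator (cell L) x \<partial>lborel) \<le>
        (\<integral>\<^sup>+x. (\<Sum>X\<in>B. ennreal (bump2 L r X x) * indicator (cell L) x) \<partial>lborel)"
    proof (intro nn_integral_mono)
      fix x
      have "ennreal (\<psi> x) \<le> (\<Sum>X\<in>B. ennreal (bump2 L r X x))"
        using le[of x] b0 by (simp add: S_def sum_ennreal less_imp_le ennreal_leI)
      then show "ennreal (\<psi> x) * indicator (cell L) x \<le> (\<Sum>X\<in>B. ennreal (bump2 L r X x) * indicator (cell L) x)"
        by (simp add: sum_distrib_right[symmetric] mult_right_mono)
    qed
    also have "\<dots> = (\<Sum>X\<in>B. \<integral>\<^sup>+x. ennreal (bump2 L r X x) * indicator (cell L) x \<partial>lborel)"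
      by (rule nn_integral_sum) (rule meas)
    also have "\<dots> \<le> (\<Sum>X\<in>B. ennreal ((48 * r)\<^sup>2))"
      using B by (intro sum_mono bump2_integral[OF L r]) auto
    also have "\<dots> = ennreal (real (card B) * (48 * r)\<^sup>2)"
      by (simp add: ennreal_mult ennreal_of_nat_eq_real_of_nat)
    finally show "(\<integral>\<^sup>+x. ennreal (\<psi> x) * indicator (cell L) x \<partial>lborel) \<le> ennreal (real (card B) * (48 * r)\<^sup>2)" .
  qed
qed

section \<open>Atomic measures\<close>

text \<open>
  A purely atomic measure for which the square roots of the masses have a sum at most \<open>p\<close> is
  concentrated, up to half of its mass, on the atoms of mass at least \<open>(\<Phi> / (2 * p))\<^sup>2\<close>: the
  smaller ones carry at most \<open>\<Phi> / (2 * p)\<close> times the sum of the roots.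
\<close>

lemma purely_atomic_sqrt_sum:
  assumes at: "purely_atomic L \<sigma>" and fin: "\<sigma> \<in> finite_measures_on (cell L)"
    and mass: "emeasure \<sigma> (cell L) = ennreal \<Phi>" and \<Phi>: "\<Phi> > 0"
  defines "P \<equiv> \<integral>\<^sup>+x. ennreal (sqrt (measure \<sigma> {x})) \<partial>count_space (cell L)"
  shows sqrt_mass_le_sqrt_sum: "ennreal (sqrt \<Phi>) \<le> P"
    and few_atoms_carry_half: "P \<le> ennreal p \<Longrightarrow> p > 0 \<Longrightarrow>
      \<exists>B. finite B \<and> B \<subseteq> cell L \<and> real (card B) \<le> 2 * p\<^sup>2 / \<Phi> \<and> measure \<sigma> B \<ge> \<Phi> / 2"
proof -
  interpret finite_measure \<sigma> using finite_measures_onD[OF fin] by simp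
  have sets: "A \<in> sets \<sigma> \<longleftrightarrow> A \<subseteq> cell L \<and> A \<in> sets borel" for A
    using finite_measures_onD[OF fin] by simp
  obtain S \<phi> where S: "countable S" "S \<subseteq> cell L" "\<And>X. X \<in> S \<Longrightarrow> \<phi> X > (0::real)"
    and em: "\<And>A. A \<in> sets \<sigma> \<Longrightarrow>
      emeasure \<sigma> A = (\<integral>\<^sup>+X. ennreal (\<phi> X) * indicator A X \<partial>count_space S)"
    using at unfolding purely_atomic_def by blast
  have atom: "measure \<sigma> {X} = \<phi> X" if "X \<in> S" for X
  proof -
    have "emeasure \<sigma> {X} = (\<integral>\<^sup>+Y. ennreal (\<phi> Y) * indicator {X} Y \<partial>count_space S)"
      using that S by (intro em) (auto simp: sets)
    also have "\<dots> = ennreal (\<phi> X)"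
      using that by (subst nn_integral_indicator_singleton) auto
    finally show ?thesis using S(3)[OF that] by (simp add: measure_def)
  qed
  have roots: "(\<integral>\<^sup>+X. ennreal (sqrt (\<phi> X)) \<partial>count_space S) \<le> P"
  proof -
    have "(\<integral>\<^sup>+X. ennreal (sqrt (\<phi> X)) \<partial>count_space S) =
        (\<integral>\<^sup>+X. ennreal (sqrt (measure \<sigma> {X})) * indicator S X \<partial>count_space UNIV)"
      by (subst nn_integral_count_space_indicator)
         (auto intro!: nn_integral_cong simp: atom indicator_def)
    also have "\<dots> \<le> (\<integral>\<^sup>+X. ennreal (sqrt (measure \<sigma> {X})) * indicator (cell L) X \<partial>count_space UNIV)"
      using S(2) by (intro nn_integral_mono) (auto simp: indicator_def)
    also have "\<dots> = P" unfolding P_def by (subst nn_integral_count_space_indicator) auto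
    finally show ?thesis .
  qed
  have cell: "cell L \<in> sets \<sigma>" by (simp add: sets)
  have total: "ennreal \<Phi> = (\<integral>\<^sup>+X. ennreal (\<phi> X) \<partial>count_space S)"
    unfolding mass[symmetric] em[OF cell]
    using S(2) by (intro nn_integral_cong) (auto simp: indicator_def)
  have sq: "\<phi> X = sqrt (\<phi> X) * sqrt (\<phi> X)" if "X \<in> S" for X
    using S(3)[OF that] by simp
  show "ennreal (sqrt \<Phi>) \<le> P"
  proof (cases P)
    case (real q)
    have "ennreal \<Phi> \<le> (\<integral>\<^sup>+X. ennreal (sqrt \<Phi>) * ennreal (sqrt (\<phi> X)) \<partial>count_space S)"
      unfolding total
    proof (intro nn_integral_mono)
      fix X assume "X \<in> space (count_space S)"
      then have X: "X \<in> S" by simp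
      have "measure \<sigma> {X} \<le> measure \<sigma> (cell L)"
        using X S(2) cell by (intro finite_measure_mono) auto
      then have "\<phi> X \<le> \<Phi>"
        using \<Phi> mass by (simp add: measure_def[of _ "cell L"] atom[OF X])
      then have "\<phi> X \<le> sqrt \<Phi> * sqrt (\<phi> X)"
        using sq[OF X] S(3)[OF X] by (metis mult_right_mono real_sqrt_ge_zero real_sqrt_le_mono less_imp_le)
      then show "ennreal (\<phi> X) \<le> ennreal (sqrt \<Phi>) * ennreal (sqrt (\<phi> X))"
        using \<Phi> S(3)[OF X] by (simp add: ennreal_mult[symmetric] ennreal_leI)
    qed
    also have "\<dots> = ennreal (sqrt \<Phi>) * (\<integral>\<^sup>+X. ennreal (sqrt (\<phi> X)) \<partial>count_space S)"
      by (rule nn_integral_cmult) simp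
    also have "\<dots> \<le> ennreal (sqrt \<Phi>) * ennreal q"
      using roots real by (intro mult_left_mono) auto
    finally have "sqrt \<Phi> * sqrt \<Phi> \<le> sqrt \<Phi> * q"
      using \<Phi> real by (simp add: ennreal_mult[symmetric])
    then have "sqrt \<Phi> \<le> q" by (rule mult_left_le_imp_le) (use \<Phi> in simp)
    then show ?thesis using real by (simp add: ennreal_leI)
  qed simp
  show "\<exists>B. finite B \<and> B \<subseteq> cell L \<and> real (card B) \<le> 2 * p\<^sup>2 / \<Phi> \<and> measure \<sigma> B \<ge> \<Phi> / 2"
    if P: "P \<le> ennreal p" and p: "p > 0"
  proof -
    define \<theta> where "\<theta> = \<Phi> / (2 * p)"
    have \<theta>: "\<theta> > 0" using \<Phi> p by (simp add: \<theta>_def)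
    define B where "B = {X \<in> S. sqrt (\<phi> X) \<ge> \<theta>}"
    have BS: "B \<subseteq> S" by (auto simp: B_def)
    have roots_p: "(\<integral>\<^sup>+X. ennreal (sqrt (\<phi> X)) \<partial>count_space S) \<le> ennreal p"
      using roots P by (rule order_trans)
    have count: "ennreal \<theta> * emeasure (count_space S) B \<le> ennreal p"
    proof -
      have "ennreal \<theta> * emeasure (count_space S) B = (\<integral>\<^sup>+X. ennreal \<theta> * indicator B X \<partial>count_space S)"
        using BS by (subst nn_integral_cmult) auto
      also have "\<dots> \<le> (\<integral>\<^sup>+X. ennreal (sqrt (\<phi> X)) \<partial>count_space S)"
        by (intro nn_integral_mono) (auto simp: B_def indicator_def intro: ennreal_leI)
      finally show ?thesis using roots_p by (rule order_trans)
    qed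
    have finB: "finite B"
    proof (rule ccontr)
      assume "infinite B"
      then have "emeasure (count_space S) B = top" using BS by simp
      then show False using count \<theta> by (simp add: ennreal_mult_top top_unique)
    qed
    have "ennreal (\<theta> * real (card B)) \<le> ennreal p"
      using count finB BS \<theta> by (simp add: ennreal_mult ennreal_of_nat_eq_real_of_nat)
    then have "\<theta> * real (card B) \<le> p" using p by simp
    then have card: "real (card B) \<le> 2 * p\<^sup>2 / \<Phi>"
      using \<Phi> p by (simp add: \<theta>_def field_simps power2_eq_square)
    have B: "B \<in> sets \<sigma>" using BS S(2) finB by (auto simp: sets finite_imp_closed borel_closed)
    have "ennreal \<Phi> \<le> (\<integral>\<^sup>+X. ennreal (\<phi> X) * indicator B X + ennreal \<theta> * ennreal (sqrt (\<phi> X)) \<partial>count_space S)"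
      unfolding total
    proof (intro nn_integral_mono)
      fix X assume "X \<in> space (count_space S)"
      then have X: "X \<in> S" by simp
      show "ennreal (\<phi> X) \<le> ennreal (\<phi> X) * indicator B X + ennreal \<theta> * ennreal (sqrt (\<phi> X))"
      proof (cases "X \<in> B")
        case False
        then have "sqrt (\<phi> X) * sqrt (\<phi> X) \<le> \<theta> * sqrt (\<phi> X)"
          using X S(3)[OF X] by (intro mult_right_mono) (auto simp: B_def)
        then show ?thesis
          using False \<theta> S(3)[OF X] sq[OF X] by (simp add: ennreal_mult[symmetric] ennreal_leI)
      qed simp
    qed
    also have "\<dots> = emeasure \<sigma> B + ennreal \<theta> * (\<integral>\<^sup>+X. ennreal (sqrt (\<phi> X)) \<partial>count_space S)"
      by (simp add: nn_integral_add nn_integral_cmult em[OF B])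
    also have "\<dots> \<le> ennreal (measure \<sigma> B) + ennreal \<theta> * ennreal p"
      using roots_p by (intro add_mono mult_left_mono) (auto simp: emeasure_eq_measure)
    also have "\<dots> = ennreal (measure \<sigma> B + \<Phi> / 2)"
      using \<Phi> \<theta> p by (simp add: ennreal_mult[symmetric] ennreal_plus[symmetric] \<theta>_def del: ennreal_plus)
    finally have "\<Phi> \<le> measure \<sigma> B + \<Phi> / 2"
      using \<Phi> by (subst (asm) ennreal_le_iff) auto
    then show ?thesis using finB card BS S(2) by (intro exI[of _ B]) auto
  qed
qed

section \<open>The lower bound\<close>

lemma nn_integral_uniform_cell:
  assumes "f \<in> borel_measurable borel"
  shows "(\<integral>\<^sup>+x. f x \<partial>uniform_cell L \<Phi>) =
    ennreal (\<Phi> / L\<^sup>2) * (\<integral>\<^sup>+x. f x * indicator (cell L) x \<partial>lborel)"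
proof -
  have "f \<in> borel_measurable (restrict_space lborel (cell L))"
    using assms by (simp add: measurable_restrict_space1)
  then show ?thesis
    unfolding uniform_cell_def
    by (subst nn_integral_scale_measure) (auto simp: nn_integral_restrict_space)
qed

text \<open>The function \<open>1\<close> has gradient \<open>0\<close>, so its slice integrals do not vary at all.\<close>

lemma (in sliced_measure) slice_mass:
  assumes L: "L > 0" and \<Phi>: "\<Phi> \<ge> 0"
    and cont: "continuous_on {-T..T} (\<lambda>t. \<integral>x. (1::real) \<partial>\<nu> t)"
    and top: "\<nu> T = uniform_cell L \<Phi>" and m: "m \<in> fluxes L T \<mu>" and t: "t \<in> I"
  shows "emeasure (\<nu> t) (cell L) = ennreal \<Phi>"
proof -
  interpret finite_measure "\<nu> t" using slice_finite[OF t] .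
  have "(\<integral>\<^sup>+x. 1 \<partial>\<nu> T) = ennreal (\<Phi> / L\<^sup>2) * ennreal (L\<^sup>2)"
    unfolding top using emeasure_cell[OF L] by (subst nn_integral_uniform_cell) simp_all
  also have "\<dots> = ennreal \<Phi>" using L \<Phi> by (simp add: ennreal_mult[symmetric])
  finally have T\<Phi>: "(\<integral>x. (1::real) \<partial>\<nu> T) = \<Phi>"
    using \<Phi> by (simp add: measure_def)
  have "\<bar>(\<integral>x. (1::real) \<partial>\<nu> t) - (\<integral>x. (1::real) \<partial>\<nu> T)\<bar> \<le> 0"
  proof (rule slice_integral_variation[OF cont m, where C = 0 and M = 0])
    show "Ck n (\<lambda>_ :: real^2. 1)" for n by (rule Ck_const)
  qed (use t in \<open>auto simp: periodic_def norm_eq_zero[THEN iffD2] vec_eq_iff\<close>)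
  then have "(\<integral>x. (1::real) \<partial>\<nu> t) = \<Phi>" using T\<Phi> by linarith
  then have "measure (\<nu> t) (cell L) = \<Phi>" by (simp add: space_slice[OF t])
  then show ?thesis by (simp add: emeasure_eq_measure)
qed

lemma (in sliced_measure) total_mass:
  assumes T: "T > 0" and mass: "\<And>t. t \<in> I \<Longrightarrow> emeasure (\<nu> t) (cell L) = ennreal \<Phi>"
    and \<Phi>: "\<Phi> \<ge> 0"
  shows "emeasure \<mu> (space \<mu>) = ennreal (2 * T * \<Phi>)"
proof -
  have "emeasure \<mu> (space \<mu>) = (\<integral>\<^sup>+p. 1 * 1 \<partial>\<mu>)" by simp
  also have "\<dots> = (\<integral>\<^sup>+t. 1 * ((\<integral>\<^sup>+x. 1 \<partial>\<nu> t) * indicator I t) \<partial>lborel)"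
    by (rule nn_integral_slicing) simp_all
  also have "\<dots> = (\<integral>\<^sup>+t. ennreal \<Phi> * indicator I t \<partial>lborel)"
    by (intro nn_integral_cong) (auto simp: space_slice mass indicator_def)
  also have "\<dots> = ennreal (2 * T * \<Phi>)"
    using T \<Phi> by (simp add: nn_integral_cmult ennreal_mult[symmetric] mult_ac)
  finally show ?thesis .
qed

text \<open>
  A slice with half of its mass on few points is far from uniform. The test function is at least
  \<open>1/2\<close> at these points, and the radius \<open>r\<close> is chosen such that its mean over the cell is at
  most \<open>1/8\<close>; its integral is therefore at least \<open>\<Phi>/4\<close> on the slice and at most \<open>\<Phi>/8\<close> on the
  uniform trace. With gradient of order \<open>1/r\<close>, this difference has to be paid for by the flux.
\<close>

lemma (in sliced_measure) transport_cost:
  assumes L: "L > 0" and T: "T > 0" and \<Phi>: "\<Phi> > 0"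
    and wcs: "weakly_continuous_slicing L T \<mu> \<nu>"
    and top: "\<nu> T = uniform_cell L \<Phi>" and m: "m \<in> fluxes L T \<mu>"
    and t: "t \<in> I"
    and B: "finite B" "B \<subseteq> cell L" "measure (\<nu> t) B \<ge> \<Phi> / 2"
    and b: "(\<integral>\<^sup>+p. ennreal ((norm (vector_RN_deriv \<mu> m p))\<^sup>2) \<partial>\<mu>) = ennreal b" "b \<ge> 0"
  shows "\<Phi> * L\<^sup>2 \<le> 9437184 * T * real (card B) * b"
proof -
  interpret finite_measure "\<nu> t" using slice_finite[OF t] .
  have cont: "continuous_on {-T..T} (\<lambda>t. \<integral>x. \<psi> x \<partial>\<nu> t)"
    if "continuous_on UNIV \<psi>" "periodic L \<psi>" for \<psi> :: "real^2 \<Rightarrow> real"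
    using wcs that by (simp add: weakly_continuous_slicing_def)
  have mass: "emeasure (\<nu> s) (cell L) = ennreal \<Phi>" if "s \<in> I" for s
    using \<Phi> by (intro slice_mass[OF L _ cont top m that]) (auto simp: periodic_def)
  have space: "emeasure \<mu> (space \<mu>) = ennreal (2 * T * \<Phi>)"
    using T \<Phi> by (intro total_mass mass) auto
  define N where "N = real (card B)"
  have "B \<noteq> {}" using B(3) \<Phi> by auto
  then have N: "N > 0" using B(1) by (simp add: N_def card_gt_0_iff)
  \<comment> \<open>Solves \<open>N * (48 * r)\<^sup>2 = L\<^sup>2 / 8\<close>, where \<open>48 * r\<close> is the width of a bump in the
    integral bound for the test function.\<close>
  define r where "r = L / (48 * sqrt (8 * N))"
  have r: "r > 0" using L N by (simp add: r_def)
  have r2: "r\<^sup>2 = L\<^sup>2 / (18432 * N)" using N by (simp add: r_def power_divide power_mult_distrib)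
  obtain \<psi> :: "real^2 \<Rightarrow> real" where \<psi>: "\<And>n. Ck n \<psi>" "periodic L \<psi>" "\<And>x. \<psi> x \<in> {0..1}"
    "\<And>x. norm (\<chi> i. frechet_derivative \<psi> (at x) (axis i 1) :: real^2) \<le> 2 / r"
    "\<And>X. X \<in> B \<Longrightarrow> \<psi> X \<ge> 1 / 2"
    "(\<integral>\<^sup>+x. ennreal (\<psi> x) * indicator (cell L) x \<partial>lborel) \<le> ennreal (real (card B) * (48 * r)\<^sup>2)"
    by (rule concentrating_function[OF L r B(1,2)]) (rule that, blast+)
  have c\<psi>: "continuous_on UNIV \<psi>" using \<psi>(1)[of 0] by simp
  have m\<psi>: "\<psi> \<in> borel_measurable borel" using c\<psi> by (rule borel_measurable_continuous_onI)
  let ?F = "\<lambda>t. \<integral>x. \<psi> x \<partial>\<nu> t"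
  have low: "?F t \<ge> \<Phi> / 4"
  proof -
    have Bs: "B \<in> sets (\<nu> t)"
      using B(1,2) by (auto simp: sets_slice[OF t] sets_restrict_space_iff finite_imp_closed borel_closed)
    have "ennreal (\<Phi> / 4) \<le> ennreal (1 / 2 * measure (\<nu> t) B)"
      using B(3) by (intro ennreal_leI) simp
    also have "\<dots> = ennreal (1 / 2) * emeasure (\<nu> t) B"
      unfolding emeasure_eq_measure by (rule ennreal_mult) simp_all
    also have "\<dots> = (\<integral>\<^sup>+x. ennreal (1 / 2) * indicator B x \<partial>\<nu> t)"
      by (rule nn_integral_cmult_indicator[OF Bs, symmetric])
    also have "\<dots> \<le> (\<integral>\<^sup>+x. ennreal (\<psi> x) \<partial>\<nu> t)"
    proof (intro nn_integral_mono)
      fix x show "ennreal (1 / 2) * indicator B x \<le> ennreal (\<psi> x)"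
        using ennreal_leI[OF \<psi>(5)] by (cases "x \<in> B") (simp_all only: indicator_simps simp_thms mult_1_right mult_zero_right zero_le)
    qed
    also have "\<dots> = ennreal (?F t)" using slice_integral_nn[OF m\<psi> \<psi>(3) t] .
    moreover have "?F t \<ge> 0" using \<psi>(3) by (intro Bochner_Integration.integral_nonneg) auto
    ultimately show ?thesis by (simp add: ennreal_le_iff)
  qed
  have up: "?F T \<le> \<Phi> / 8"
  proof -
    have "(\<integral>\<^sup>+x. ennreal (\<psi> x) \<partial>\<nu> T) \<le> ennreal (\<Phi> / L\<^sup>2) * ennreal (N * (48 * r)\<^sup>2)"
      unfolding top using m\<psi> \<psi>(6)
      by (subst nn_integral_uniform_cell) (auto intro!: mult_left_mono simp: N_def)
    also have "\<dots> = ennreal (\<Phi> / L\<^sup>2 * (N * (48 * r)\<^sup>2))"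
      using \<Phi> N by (intro ennreal_mult[symmetric]) auto
    also have "\<Phi> / L\<^sup>2 * (N * (48 * r)\<^sup>2) = \<Phi> / 8"
      using L N by (simp add: power_mult_distrib r2 field_simps)
    finally have *: "(\<integral>\<^sup>+x. ennreal (\<psi> x) \<partial>\<nu> T) \<le> ennreal (\<Phi> / 8)" .
    have "\<nu> T \<in> finite_measures_on (cell L)"
      using wcs T by (auto simp: weakly_continuous_slicing_def)
    note sets = finite_measures_onD(2)[OF this cell_borel]
    have "\<psi> \<in> borel_measurable (\<nu> T)"
      using m\<psi> by (simp add: measurable_cong_sets[OF sets refl] measurable_restrict_space1)
    then have "?F T = enn2real (\<integral>\<^sup>+x. ennreal (\<psi> x) \<partial>\<nu> T)"
      using \<psi>(3) by (intro integral_eq_nn_integral) auto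
    then show ?thesis using enn2real_leI[OF _ *] \<Phi> by simp
  qed
  define M where "M = sqrt ((2 / r)\<^sup>2 * (2 * T * \<Phi>) * b)"
  have M2: "M\<^sup>2 = (2 / r)\<^sup>2 * (2 * T * \<Phi>) * b" and M0: "M \<ge> 0"
    using T \<Phi> b by (auto simp: M_def)
  have "\<bar>?F t - ?F T\<bar> \<le> M"
  proof (rule slice_integral_variation[OF cont[OF c\<psi> \<psi>(2)] m \<psi>(1,2,3) _ \<psi>(4) _ M0 t])
    show "0 \<le> 2 / r" using r by simp
    show "ennreal ((2 / r)\<^sup>2) * emeasure \<mu> (space \<mu>) *
        (\<integral>\<^sup>+p. ennreal ((norm (vector_RN_deriv \<mu> m p))\<^sup>2) \<partial>\<mu>) \<le> ennreal (M\<^sup>2)"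
      using T \<Phi> b unfolding space b(1) M2 by (simp add: ennreal_mult[symmetric])
  qed
  then have "\<Phi> / 8 \<le> M" using low up by linarith
  then have "(\<Phi> / 8)\<^sup>2 \<le> M\<^sup>2" using \<Phi> by (intro power_mono) auto
  also have "M\<^sup>2 = \<Phi> * (8 * T * b) / r\<^sup>2"
    unfolding M2 by (simp add: power_divide field_simps)
  also have "\<dots> = \<Phi> * (147456 * T * N * b) / L\<^sup>2"
    using L N by (simp add: r2 field_simps)
  finally have "\<Phi> * (\<Phi> / 64) \<le> \<Phi> * (147456 * T * N * b / L\<^sup>2)"
    by (simp add: power2_eq_square)
  then have "\<Phi> / 64 \<le> 147456 * T * N * b / L\<^sup>2"
    using \<Phi> by (rule mult_left_le_imp_le)
  then show ?thesis using L by (simp add: N_def field_simps)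
qed

text \<open>
  The interpolation step: a product bound \<open>\<Phi>\<^sup>2 * L\<^sup>2 * T \<le> C * a\<^sup>2 * b\<close> bounds the sum \<open>a + b\<close>
  from below because \<open>a\<^sup>2 * b \<le> (a + b)\<^sup>3\<close>. The constant \<open>27000000\<close> is the cube of \<open>300\<close>.
\<close>

lemma interpolation:
  fixes a b L T \<Phi> :: real
  assumes pos: "L > 0" "T > 0" "\<Phi> > 0" and b: "b \<ge> 0"
    and a: "2 * T * sqrt \<Phi> \<le> a"
    and prod: "\<Phi>\<^sup>2 * L\<^sup>2 * T \<le> 27000000 * a\<^sup>2 * b"
  shows "1 / 600 * (T * \<Phi> powr (1/2) / L\<^sup>2 + T powr (1/3) * \<Phi> powr (2/3) / L powr (4/3)) \<le> (a + b) / L\<^sup>2"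
proof -
  define q where "q = T powr (1/3) * \<Phi> powr (2/3) * L powr (2/3)"
  have a0: "a > 0" using a pos by (smt (verit) mult_pos_pos real_sqrt_gt_zero)
  have q0: "q \<ge> 0" by (simp add: q_def)
  have "q ^ 3 = \<Phi>\<^sup>2 * L\<^sup>2 * T"
    using pos by (simp add: q_def power_mult_distrib powr_realpow[symmetric] powr_powr powr_numeral[symmetric] del: powr_numeral)
  also have "\<dots> \<le> 27000000 * (a\<^sup>2 * b)" using prod by simp
  also have "a\<^sup>2 * b \<le> (a + b)\<^sup>2 * (a + b)"
    using a0 b by (intro mult_mono power_mono) auto
  also have "27000000 * ((a + b)\<^sup>2 * (a + b)) = (300 * (a + b)) ^ 3"
    unfolding power_mult_distrib by (simp add: power2_eq_square power3_eq_cube del: distrib_left_numeral)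
  finally have "q ^ 3 \<le> (300 * (a + b)) ^ 3" by simp
  then have q: "q \<le> 300 * (a + b)"
    using a0 b by (intro power_le_imp_le_base[of q 2]) (auto simp: numeral_3_eq_3)
  have "L powr (4/3) * L powr (2/3) = L\<^sup>2"
    using pos by (simp add: powr_add[symmetric])
  then have "T powr (1/3) * \<Phi> powr (2/3) / L powr (4/3) = q / L\<^sup>2"
    using pos by (simp add: q_def field_simps)
  moreover have "T * \<Phi> powr (1/2) \<le> (a + b) / 2"
    using a b pos by (simp add: powr_half_sqrt)
  ultimately have "1 / 600 * (T * \<Phi> powr (1/2) / L\<^sup>2 + T powr (1/3) * \<Phi> powr (2/3) / L powr (4/3)) =
      (T * \<Phi> powr (1/2) + q) / 600 / L\<^sup>2"
    by (simp add: add_divide_distrib)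
  also have "\<dots> \<le> (a + b) / L\<^sup>2"
    using \<open>T * \<Phi> powr (1/2) \<le> (a + b) / 2\<close> q a0 b by (intro divide_right_mono) auto
  finally show ?thesis .
qed

lemma K_star_ge_1: "K_star \<ge> 1"
proof -
  have "sqrt pi \<ge> 1" using pi_ge_two by simp
  then show ?thesis unfolding K_star_def by linarith
qed

text \<open>
  Some slice has a sum of roots at most \<open>a / T\<close>, since \<open>a\<close> is the integral of these sums over an
  interval of length \<open>2 * T\<close>; its large atoms enter the transport estimate. The sums of roots
  are only ever bounded below by constants, and this survives integration whether or not they
  are measurable in the height.
\<close>

lemma energy_lower_bound:
  assumes L: "L > 0" and T: "T > 0" and \<Phi>: "\<Phi> > 0"
    and adm: "\<mu> \<in> admissible_star L T"
    and trace: "has_trace L T \<mu> T (uniform_cell L \<Phi>)"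
    and m: "m \<in> fluxes L T \<mu>"
  shows "energy L T \<mu> m \<ge>
    ennreal (1 / 600 * (T * \<Phi> powr (1/2) / L\<^sup>2 + T powr (1/3) * \<Phi> powr (2/3) / L powr (4/3)))"
proof -
  obtain \<nu>' where fin: "\<mu> \<in> finite_measures_on (cyl L T)" and slc': "slicing L T \<mu> \<nu>'"
    and atomic: "AE t in lborel. t \<in> {-T<..<T} \<longrightarrow> purely_atomic L (\<nu>' t)"
    using adm by (auto simp: admissible_star_def admissible_def)
  obtain \<nu> where wcs: "weakly_continuous_slicing L T \<mu> \<nu>" and top: "\<nu> T = uniform_cell L \<Phi>"
    using trace by (auto simp: has_trace_def)
  have slc: "slicing L T \<mu> \<nu>" using wcs by (simp add: weakly_continuous_slicing_def)
  interpret sliced_measure L T \<mu> \<nu> by unfold_locales fact+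
  \<comment> \<open>Three slicings meet here: the one chosen in the energy, the weakly continuous one, and the
    one that witnesses that the slices are atomic.\<close>
  have "slicing L T \<mu> (slice L T \<mu>)" 
    using someI[of "slicing L T \<mu>", OF slc] by (simp add: slice_def)
  from slicing_AE_unique[OF fin this slc] slicing_AE_unique[OF fin slc slc'] atomic
  have good: "AE t in lborel. t \<in> I \<longrightarrow> slice L T \<mu> t = \<nu> t \<and> purely_atomic L (\<nu> t)"
    by eventually_elim auto
  have cont: "continuous_on {-T..T} (\<lambda>t. \<integral>x. \<psi> x \<partial>\<nu> t)"
    if "continuous_on UNIV \<psi>" "periodic L \<psi>" for \<psi> :: "real^2 \<Rightarrow> real"
    using wcs that by (simp add: weakly_continuous_slicing_def)
  have mass: "emeasure (\<nu> t) (cell L) = ennreal \<Phi>" if "t \<in> I" for t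
    using \<Phi> by (intro slice_mass[OF L _ cont top m that]) (auto simp: periodic_def)
  define P where "P t = (\<integral>\<^sup>+x. ennreal (sqrt (measure (slice L T \<mu> t) {x})) \<partial>count_space (cell L))" for t
  define A where "A = (\<integral>\<^sup>+t\<in>I. P t \<partial>lborel)"
  define V where "V = (\<integral>\<^sup>+p. ennreal ((norm (vector_RN_deriv \<mu> m p))\<^sup>2) \<partial>\<mu>)"
  have energy: "energy L T \<mu> m = ennreal (K_star / L\<^sup>2) * A + ennreal (1 / L\<^sup>2) * V"
    by (simp add: energy_def A_def P_def V_def)
  have lower: "ennreal (2 * T * c) \<le> A" if "AE t in lborel. t \<in> I \<longrightarrow> ennreal c \<le> P t" "c \<ge> 0" for c
  proof -
    have "ennreal (2 * T * c) = (\<integral>\<^sup>+t. ennreal c * indicator I t \<partial>lborel)"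
      using T that(2) by (simp add: nn_integral_cmult ennreal_mult[symmetric] mult_ac)
    also have "\<dots> \<le> A"
      unfolding A_def using that(1) by (intro nn_integral_mono_AE) (auto simp: indicator_def)
    finally show ?thesis .
  qed
  have A_low: "ennreal (2 * T * sqrt \<Phi>) \<le> A"
  proof (rule lower)
    show "AE t in lborel. t \<in> I \<longrightarrow> ennreal (sqrt \<Phi>) \<le> P t"
      using good
    proof eventually_elim
      case (elim t)
      then show ?case
        using sqrt_mass_le_sqrt_sum[OF _ slice_fin mass \<Phi>, of t] by (auto simp: P_def)
    qed
  qed (use \<Phi> in simp)
  have KL: "K_star / L\<^sup>2 > 0" using K_star_ge_1 L by simp
  show ?thesis
  proof (cases "A = top \<or> V = top")
    case True
    then have "energy L T \<mu> m = top"
      using KL L by (auto simp: energy ennreal_mult_top ennreal_mult_eq_top_iff)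
    then show ?thesis by simp
  next
    case False
    then obtain a b where a: "A = ennreal a" "a \<ge> 0" and b: "V = ennreal b" "b \<ge> 0"
      by (metis ennreal_cases)
    have a_low: "2 * T * sqrt \<Phi> \<le> a" using A_low a by (simp add: a(1))
    then have a0: "a > 0" using T \<Phi> by (smt (verit) mult_pos_pos real_sqrt_gt_zero)
    have "\<exists>t\<in>I. slice L T \<mu> t = \<nu> t \<and> purely_atomic L (\<nu> t) \<and> P t \<le> ennreal (a / T)"
    proof (rule ccontr)
      assume "\<not> ?thesis"
      then have "AE t in lborel. t \<in> I \<longrightarrow> ennreal (a / T) \<le> P t"
        using good by (auto elim!: eventually_mono intro: less_imp_le simp: not_le)
      from lower[OF this] have "ennreal (2 * a) \<le> ennreal a" using a0 T by (simp add: a(1))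
      then show False using a0 by simp
    qed
    then obtain t where t: "t \<in> I" "slice L T \<mu> t = \<nu> t" "purely_atomic L (\<nu> t)" "P t \<le> ennreal (a / T)"
      by blast
    obtain B where B: "finite B" "B \<subseteq> cell L" "real (card B) \<le> 2 * (a / T)\<^sup>2 / \<Phi>" "measure (\<nu> t) B \<ge> \<Phi> / 2"
      using few_atoms_carry_half[OF t(3) slice_fin[OF t(1)] mass[OF t(1)] \<Phi>, of "a / T"] t(4) a0 T
      by (auto simp: P_def t(2))
    have "\<Phi> * L\<^sup>2 \<le> 9437184 * T * real (card B) * b"
      by (rule transport_cost[OF L T \<Phi> wcs top m t(1) B(1,2,4) b(1)[unfolded V_def] b(2)])
    also have "\<dots> \<le> 9437184 * T * (2 * (a / T)\<^sup>2 / \<Phi>) * b"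
      using B(3) T b by (intro mult_right_mono mult_left_mono) auto
    finally have "\<Phi> * L\<^sup>2 \<le> 18874368 * a\<^sup>2 * b / (\<Phi> * T)"
      using T \<Phi> by (simp add: power_divide power2_eq_square field_simps)
    then have "\<Phi>\<^sup>2 * L\<^sup>2 * T \<le> 18874368 * a\<^sup>2 * b"
      using T \<Phi> by (simp add: field_simps power2_eq_square)
    also have "\<dots> \<le> 27000000 * a\<^sup>2 * b" using b by (intro mult_right_mono) auto
    finally have prod: "\<Phi>\<^sup>2 * L\<^sup>2 * T \<le> 27000000 * a\<^sup>2 * b" .
    have "ennreal (1 / 600 * (T * \<Phi> powr (1/2) / L\<^sup>2 + T powr (1/3) * \<Phi> powr (2/3) / L powr (4/3))) \<le>
        ennreal ((a + b) / L\<^sup>2)"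
      by (intro ennreal_leI interpolation[OF L T \<Phi> b(2) a_low prod])
    also have "\<dots> \<le> ennreal (K_star / L\<^sup>2 * a + 1 / L\<^sup>2 * b)"
    proof (rule ennreal_leI)
      have "a * 1 \<le> a * K_star" using a K_star_ge_1 by (intro mult_left_mono) auto
      then have "(a + b) / L\<^sup>2 \<le> (a * K_star + b) / L\<^sup>2" by (intro divide_right_mono) auto
      then show "(a + b) / L\<^sup>2 \<le> K_star / L\<^sup>2 * a + 1 / L\<^sup>2 * b" by (simp add: add_divide_distrib mult_ac)
    qed
    also have "\<dots> = ennreal (K_star / L\<^sup>2 * a) + ennreal (1 / L\<^sup>2 * b)"
      using a(2) b(2) K_star_ge_1 by (intro ennreal_plus) auto
    also have "\<dots> = energy L T \<mu> m"
      unfolding energy a(1) b(1) using a b KL by (subst (1 2) ennreal_mult) auto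
    finally show ?thesis .
  qed
qed

theorem proposition5p3:
  "\<exists>c::real. c > 0 \<and>
     (\<forall>(L::real) (T::real) (\<Phi>::real) (\<mu> :: ((real^2) \<times> real) measure).
        L > 0 \<longrightarrow> T > 0 \<longrightarrow> \<Phi> \<ge> 0 \<longrightarrow>
        \<mu> \<in> admissible_star L T \<longrightarrow>
        has_trace L T \<mu> T (uniform_cell L \<Phi>) \<longrightarrow>
        has_trace L T \<mu> (-T) (uniform_cell L \<Phi>) \<longrightarrow>
        min_energy L T \<mu> \<ge>
          ennreal (c * (T * \<Phi> powr (1/2) / L\<^sup>2
                      + T powr (1/3) * \<Phi> powr (2/3) / L powr (4/3))))"
proof (intro exI[of _ "1 / 600"] conjI allI impI)
  fix L T \<Phi> :: real and \<mu> :: "((real^2) \<times> real) measure"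
  assume *: "L > 0" "T > 0" "\<Phi> \<ge> 0" "\<mu> \<in> admissible_star L T"
    "has_trace L T \<mu> T (uniform_cell L \<Phi>)" "has_trace L T \<mu> (-T) (uniform_cell L \<Phi>)"
  show "ennreal (1 / 600 * (T * \<Phi> powr (1/2) / L\<^sup>2
      + T powr (1/3) * \<Phi> powr (2/3) / L powr (4/3))) \<le> min_energy L T \<mu>"
  proof (cases "\<Phi> = 0")
    case False
    then show ?thesis
      unfolding min_energy_def using * by (intro INF_greatest energy_lower_bound) auto
  qed simp
qed simp

end
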